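(* For every positive integer $k$, the rational function $H_{2k-2}(x)$ has, in lowest terms, a factor $\Psi_k(x)$ in its denominator which does not cancel with its numerator; consequently $H_{2k-2}(x)$ is singular at the zeros of $\Psi_k(x)$.
   Context: Work on the square lattice $\mathbb{Z}^2$. A bond-animal is a connected union of bonds (edges) of the lattice, considered up to translation (the single vertex with no bonds is included). It is directed if it contains a vertex (the root) such that every bond of the animal can be reached from the root by a path in the animal using only north and east steps. For a directed bond-animal $A$ let $|A|_h$ and $|A|_v$ denote its numbers of horizontal and vertical bonds. The anisotropic generating function is $B(x,y)=\sum_A x^{|A|_h}y^{|A|_v}=\sum_{n\ge 0}H_n(x)y^n$, so $H_n(x)=\sum x^{|A|_h}$ over directed bond-animals with exactly $n$ vertical bonds; each $H_n(x)$ is a rational function of $x$. $\Psi_k(x)$ denotes the $k$-th cyclotomic polynomial, normalized so that $1-x^n=\prod_{k\mid n}\Psi_k(x)$ (so $\Psi_1(x)=1-x$, $\Psi_2(x)=1+x$). *)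

theory Defs
  imports
    "HOL-Complex_Analysis.Complex_Analysis"
    "HOL-Computational_Algebra.Polynomial_Factorial"
    "HOL-Computational_Algebra.Field_as_Ring"
begin

section \<open>Directed bond-animals on the square lattice\<close>

type_synonym vertex = "int \<times> int"
type_synonym bond = "vertex set"

definition horizontal_bonds :: "bond set" where
  "horizontal_bonds = {{(i, j), (i + 1, j)} | i j. True}"

definition vertical_bonds :: "bond set" where
  "vertical_bonds = {{(i, j), (i, j + 1)} | i j. True}"

text \<open>
  An animal is recorded together with its vertex set, so that the single vertex without
  bonds is \<open>({v}, {})\<close>.  As soon as there are two vertices, connectedness forces the vertex
  set to be the set of end points of the bonds.
\<close>

type_synonym animal = "vertex set \<times> bond set"

definition bond_animal :: "animal \<Rightarrow> bool" where
  "bond_animal A \<longleftrightarrow> (case A of (V, E) \<Rightarrow>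
     finite V \<and> V \<noteq> {} \<and> E \<subseteq> horizontal_bonds \<union> vertical_bonds \<and> \<Union>E \<subseteq> V \<and>
     (\<forall>u\<in>V. \<forall>v\<in>V. (u, v) \<in> {(a, b). {a, b} \<in> E}\<^sup>*))"

text \<open>The east and north steps along bonds of \<open>E\<close>.\<close>

definition NE_steps :: "bond set \<Rightarrow> (vertex \<times> vertex) set" where
  "NE_steps E = {((i, j), w) | i j w. w \<in> {(i + 1, j), (i, j + 1)} \<and> {(i, j), w} \<in> E}"

text \<open>A bond is reached from the root if it is the last step of a north-east path from it.\<close>

definition directed :: "animal \<Rightarrow> bool" where
  "directed A \<longleftrightarrow> (case A of (V, E) \<Rightarrow>
     \<exists>r\<in>V. \<forall>e\<in>E. \<exists>u v. e = {u, v} \<and> (r, u) \<in> (NE_steps E)\<^sup>* \<and> (u, v) \<in> NE_steps E)"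

definition num_h :: "animal \<Rightarrow> nat" where
  "num_h A = card (snd A \<inter> horizontal_bonds)"

definition num_v :: "animal \<Rightarrow> nat" where
  "num_v A = card (snd A \<inter> vertical_bonds)"

definition shift :: "vertex \<Rightarrow> vertex \<Rightarrow> vertex" where
  "shift t u = (fst u + fst t, snd u + snd t)"

definition translate :: "vertex \<Rightarrow> animal \<Rightarrow> animal" where
  "translate t A = (shift t ` fst A, (\<lambda>e. shift t ` e) ` snd A)"

definition translation_rel :: "(animal \<times> animal) set" where
  "translation_rel = {(A, B). \<exists>t. B = translate t A}"

definition directed_animals :: "nat \<Rightarrow> nat \<Rightarrow> animal set set" where
  "directed_animals m n =
     {A. bond_animal A \<and> directed A \<and> num_h A = m \<and> num_v A = n} // translation_rel"

definition H :: "nat \<Rightarrow> rat fps" where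
  "H n = Abs_fps (\<lambda>m. of_nat (card (directed_animals m n)))"

section \<open>Rational power series in lowest terms\<close>

definition lowest_terms :: "'a :: field fps \<Rightarrow> 'a poly \<Rightarrow> 'a poly \<Rightarrow> bool" where
  "lowest_terms F p q \<longleftrightarrow> coprime p q \<and> q \<noteq> 0 \<and> F * fps_of_poly q = fps_of_poly p"

section \<open>Cyclotomic polynomials\<close>

text \<open>
  The recursion solves \<open>1 - x ^ n = (\<Prod>d | d dvd n. Psi d)\<close> for the factor with \<open>d = n\<close>;
  the division is exact, as \<open>prod_Psi\<close> below confirms.
\<close>

fun Psi :: "nat \<Rightarrow> rat poly" where
  "Psi k = (1 - monom 1 k) div (\<Prod>d\<in>{d\<in>{..<k}. d dvd k}. Psi d)"

declare Psi.simps [simp del]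

lemma dvd_one_minus_monom_gcd:
  fixes p :: "rat poly"
  assumes "p dvd 1 - monom 1 a" "p dvd 1 - monom 1 b" "a > 0"
  shows "p dvd 1 - monom 1 (gcd a b)"
proof -
  have pow: "p dvd 1 - monom 1 (c * n)" if "p dvd 1 - monom 1 c" for c n
  proof (induction n)
    case 0
    show ?case by (simp add: monom_0 one_pCons)
  next
    case (Suc n)
    have "1 - monom (1::rat) (c * Suc n) = (1 - monom 1 c) + monom 1 c * (1 - monom 1 (c * n))"
      by (simp add: algebra_simps mult_monom)
    then show ?case using Suc that by (simp only: dvd_add dvd_mult)
  qed
  obtain x y where xy: "a * x = b * y + gcd a b"
    using bezout_nat[of a b] assms(3) by auto
  have "1 - monom (1::rat) (gcd a b) =
      (1 - monom 1 (a * x)) - monom 1 (gcd a b) * (1 - monom 1 (b * y))"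
    by (simp add: xy algebra_simps mult_monom)
  then show ?thesis
    using pow[OF assms(1), of x] pow[OF assms(2), of y] by (simp only: dvd_diff dvd_mult)
qed

lemma square_dvd_one_minus_monom:
  fixes p :: "rat poly"
  assumes "p * p dvd 1 - monom 1 n" "n > 0"
  shows "p dvd 1"
proof -
  obtain q where q: "1 - monom 1 n = p * p * q" using assms(1) by auto
  have "pderiv (1 - monom 1 n) = p * (2 * pderiv p * q + p * pderiv q)"
    by (simp add: q pderiv_mult algebra_simps)
  moreover have "pderiv (1 - monom (1::rat) n) = - monom (of_nat n) (n - 1)"
    by (simp add: pderiv_diff pderiv_monom)
  ultimately have "p dvd monom (of_nat n) (n - 1)"
    by (metis dvd_minus_iff dvd_triv_left)
  then have "p dvd monom (of_nat n) (n - 1) * monom (1 / of_nat n) 1" by (rule dvd_mult2)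
  also have "\<dots> = monom 1 n" using assms(2) by (simp add: mult_monom)
  finally have "p dvd monom 1 n" .
  moreover have "p dvd 1 - monom 1 n" using q by simp
  ultimately have "p dvd (1 - monom 1 n) + monom 1 n" by (rule dvd_add[rotated])
  then show ?thesis by simp
qed

theorem prod_Psi:
  assumes "n > 0"
  shows "(\<Prod>d | d dvd n. Psi d) = 1 - monom 1 n"
  using assms
proof (induction n rule: less_induct)
  case (less n)
  let ?D = "{d\<in>{..<n}. d dvd n}"
  have pos: "d > 0" if "d dvd n" for d using dvd_pos_nat[OF less.prems that] .
  have IH: "(\<Prod>e | e dvd d. Psi e) = 1 - monom 1 d" if "d \<in> ?D" for d
    using less.IH[of d] that pos by auto
  have fin: "finite {e. e dvd d}" if "d \<in> ?D" for d
    using that pos by (auto intro!: finite_divisors_nat)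
  have Psi_dvd: "Psi d dvd 1 - monom 1 d" if "d \<in> ?D" for d
    unfolding IH[OF that, symmetric] by (rule dvd_prodI) (use fin[OF that] in auto)
  have Psi_sq: "Psi d * (1 - monom 1 e) dvd 1 - monom 1 d"
    if d: "d \<in> ?D" and e: "e dvd d" "e \<noteq> d" for d e
  proof -
    have eD: "e \<in> ?D" using d e pos[of d] by (auto dest: dvd_imp_le intro: dvd_trans)
    have "Psi d * (1 - monom 1 e) = (\<Prod>c\<in>insert d {c. c dvd e}. Psi c)"
      using fin[OF eD] e by (subst prod.insert) (auto simp: IH[OF eD] dest: dvd_antisym)
    also have "\<dots> dvd (\<Prod>c | c dvd d. Psi c)"
      by (rule prod_dvd_prod_subset) (use fin[OF d] e in \<open>auto intro: dvd_trans\<close>)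
    finally show ?thesis using IH[OF d] by simp
  qed
  have cop_aux: "coprime (Psi d) (Psi e)" if d: "d \<in> ?D" and e: "e \<in> ?D" and "\<not> d dvd e" for d e
  proof (rule coprimeI)
    fix p assume p: "p dvd Psi d" "p dvd Psi e"
    have "p dvd 1 - monom 1 (gcd d e)"
      using p Psi_dvd[OF d] Psi_dvd[OF e] d pos
      by (intro dvd_one_minus_monom_gcd) (auto intro: dvd_trans)
    then have "p * p dvd Psi d * (1 - monom 1 (gcd d e))" using p by (intro mult_dvd_mono)
    also have "\<dots> dvd 1 - monom 1 d"
      by (rule Psi_sq[OF d]) (simp, metis gcd_dvd2 that(3))
    finally show "is_unit p" using d pos by (intro square_dvd_one_minus_monom) auto
  qed
  have cop: "coprime (Psi d) (Psi e)" if "d \<in> ?D" "e \<in> ?D" "d \<noteq> e" for d e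
    using cop_aux[of d e] cop_aux[of e d] that dvd_antisym[of d e] by (auto simp: coprime_commute)
  have Psi_dvd_n: "Psi d dvd 1 - monom 1 n" if d: "d \<in> ?D" for d
  proof -
    obtain k where k: "n = d * k" using d by auto
    have "1 - monom 1 d dvd 1 - monom (1::rat) (d * k)"
    proof -
      have "1 - (monom 1 d) ^ k = (1 - monom (1::rat) d) * (\<Sum>i<k. monom 1 d ^ i)"
        by (rule one_diff_power_eq)
      then show ?thesis by (simp add: monom_power)
    qed
    with Psi_dvd[OF d] show ?thesis unfolding k by (rule dvd_trans)
  qed
  have "(\<Prod>d\<in>D. Psi d) dvd 1 - monom 1 n" if "finite D" "D \<subseteq> ?D" for D
    using that
  proof (induction D rule: finite_induct)
    case empty
    show ?case by simp
  next
    case (insert d D)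
    have "coprime (Psi d) (\<Prod>e\<in>D. Psi e)"
      using insert.hyps insert.prems by (intro prod_coprime_right cop) auto
    then have "Psi d * (\<Prod>e\<in>D. Psi e) dvd 1 - monom 1 n"
      using insert by (intro divides_mult Psi_dvd_n) auto
    then show ?case using insert.hyps by simp
  qed
  from this[of ?D] have "(\<Prod>d\<in>?D. Psi d) * Psi n = 1 - monom 1 n"
    by (subst (2) Psi.simps) simp
  moreover have "{d. d dvd n} = insert n ?D"
    using less.prems by (auto dest: dvd_imp_le)
  ultimately show ?case by (simp add: mult.commute)
qed

end

theory Submission
  imports Defs "HOL-Computational_Algebra.Fundamental_Theorem_Algebra"
begin

text \<open>
  Read an animal column by column from its root. The configurations to the right of a vertical cut
  that meets the rows in \<open>A\<close> have a rational generating function, whose recursion suggests the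
  denominator \<open>1 - x ^ card A\<close>. Rows that are not joined by vertical bonds to the right of the cut are
  independent, so \<open>k\<close> rows contribute a pole at a primitive \<open>k\<close>-th root of unity \<open>\<zeta>\<close> only if they are
  consecutive and joined by \<open>k - 1\<close> bonds to the right of the cut; entering them takes \<open>k - 1\<close> further
  bonds to the left. With \<open>2 * k - 2\<close> vertical bonds this leaves only the animals on \<open>k\<close> rows with two
  bonds between any two consecutive rows. They give a simple pole at \<open>\<zeta>\<close>: the left parts contribute
  \<open>\<Prod>j=1..<k. 1 / (1 - \<zeta> ^ j)\<close>, and summing the right parts row by row gives a nonzero multiple of
  the product of the factors \<open>1 + \<zeta> - \<zeta> ^ 2 - \<zeta> ^ Suc a\<close>, \<open>1 \<le> a \<le> k - 2\<close>, which do not vanish because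
  two pairs of unit complex numbers with the same nonzero sum coincide.
\<close>

section \<open>Values of rational power series at complex points\<close>

definition ev :: "complex \<Rightarrow> rat poly \<Rightarrow> complex" where
  "ev z p = poly (map_poly of_rat p) z"

lemma ev_0 [simp]: "ev z 0 = 0"
  by (simp add: ev_def)

lemma ev_pCons: "ev z (pCons a p) = of_rat a + z * ev z p"
  by (simp add: ev_def map_poly_pCons)

lemma ev_1 [simp]: "ev z 1 = 1"
  by (simp add: one_pCons ev_pCons)

lemma ev_add [simp]: "ev z (p + q) = ev z p + ev z q"
proof (induction p q rule: poly_induct2)
  case (pCons a p b q)
  then show ?case by (simp add: ev_pCons of_rat_add algebra_simps)
qed simp

lemma ev_smult [simp]: "ev z (smult a p) = of_rat a * ev z p"
  by (induction p) (simp_all add: ev_pCons of_rat_mult algebra_simps)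

lemma ev_mult [simp]: "ev z (p * q) = ev z p * ev z q"
  by (induction p) (simp_all add: ev_pCons mult_pCons_left algebra_simps)

lemma ev_minus [simp]: "ev z (- p) = - ev z p"
  using ev_add[of z p "- p"] by (simp del: ev_add add: eq_neg_iff_add_eq_0 add.commute)

lemma ev_diff [simp]: "ev z (p - q) = ev z p - ev z q"
  using ev_add[of z p "- q"] by simp

lemma ev_prod: "ev z (prod f A) = (\<Prod>x\<in>A. ev z (f x))"
  by (induction A rule: infinite_finite_induct) simp_all

lemma ev_monom [simp]: "ev z (monom a n) = of_rat a * z ^ n"
  by (simp add: ev_def map_poly_monom poly_monom)

lemma ev_dvd: "p dvd q \<Longrightarrow> ev z p = 0 \<Longrightarrow> ev z q = 0"
  by auto

definition has_value :: "complex \<Rightarrow> rat fps \<Rightarrow> complex \<Rightarrow> bool" where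
  "has_value z F v \<longleftrightarrow>
     (\<exists>p q. F * fps_of_poly q = fps_of_poly p \<and> ev z q \<noteq> 0 \<and> v = ev z p / ev z q)"

lemma has_valueI:
  "F * fps_of_poly q = fps_of_poly p \<Longrightarrow> ev z q \<noteq> 0 \<Longrightarrow> v = ev z p / ev z q \<Longrightarrow> has_value z F v"
  unfolding has_value_def by blast

lemma has_value_poly: "has_value z (fps_of_poly p) (ev z p)"
  by (rule has_valueI[of _ 1 p]) simp_all

lemma has_value_0: "has_value z 0 0" and has_value_1: "has_value z 1 1"
  using has_value_poly[of z 0] has_value_poly[of z 1] by simp_all

lemma has_value_X_power: "has_value z (fps_X ^ n) (z ^ n)"
  using has_value_poly[of z "monom 1 n"] by (simp add: fps_of_poly_monom')

lemma has_value_X: "has_value z fps_X z"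
  using has_value_X_power[of z 1] by simp

lemma has_value_add:
  assumes "has_value z F v" "has_value z G w"
  shows "has_value z (F + G) (v + w)"
proof -
  obtain p q where 1: "F * fps_of_poly q = fps_of_poly p" "ev z q \<noteq> 0" "v = ev z p / ev z q"
    using assms(1) by (auto simp: has_value_def)
  obtain p' q' where 2: "G * fps_of_poly q' = fps_of_poly p'" "ev z q' \<noteq> 0" "w = ev z p' / ev z q'"
    using assms(2) by (auto simp: has_value_def)
  have "(F + G) * fps_of_poly (q * q') = fps_of_poly (p * q' + p' * q)"
    by (simp add: fps_of_poly_mult fps_of_poly_add flip: 1 2) (simp add: algebra_simps)
  then show ?thesis
    by (rule has_valueI) (use 1(2) 2(2) in \<open>simp_all add: 1(3) 2(3) add_frac_eq\<close>)
qed

lemma has_value_mult: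
  assumes "has_value z F v" "has_value z G w"
  shows "has_value z (F * G) (v * w)"
proof -
  obtain p q where 1: "F * fps_of_poly q = fps_of_poly p" "ev z q \<noteq> 0" "v = ev z p / ev z q"
    using assms(1) by (auto simp: has_value_def)
  obtain p' q' where 2: "G * fps_of_poly q' = fps_of_poly p'" "ev z q' \<noteq> 0" "w = ev z p' / ev z q'"
    using assms(2) by (auto simp: has_value_def)
  have "(F * G) * fps_of_poly (q * q') = fps_of_poly (p * p')"
    by (simp add: fps_of_poly_mult flip: 1 2)
  then show ?thesis
    by (rule has_valueI) (use 1 2 in simp_all)
qed

lemma has_value_minus: "has_value z F v \<Longrightarrow> has_value z (- F) (- v)"
  using has_value_mult[OF has_value_poly[of z "- 1"]] by (fastforce simp: fps_of_poly_uminus)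

lemma has_value_diff:
  "has_value z F v \<Longrightarrow> has_value z G w \<Longrightarrow> has_value z (F - G) (v - w)"
  using has_value_add[of z F v "- G" "- w"] has_value_minus[of z G w] by simp

lemma has_value_sum:
  "(\<And>i. i \<in> I \<Longrightarrow> has_value z (F i) (v i)) \<Longrightarrow> has_value z (\<Sum>i\<in>I. F i) (\<Sum>i\<in>I. v i)"
  by (induction I rule: infinite_finite_induct) (simp_all add: has_value_0 has_value_add)

lemmas has_value_intros =
  has_value_0 has_value_1 has_value_X has_value_X_power has_value_add has_value_diff
  has_value_minus has_value_mult

lemma has_value_cancel:
  assumes "has_value z ((1 - fps_X ^ c) * F) v" "z ^ c \<noteq> 1"
  shows "has_value z F (v / (1 - z ^ c))"
proof -
  obtain p q where 1: "(1 - fps_X ^ c) * F * fps_of_poly q = fps_of_poly p" "ev z q \<noteq> 0"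
    "v = ev z p / ev z q"
    using assms(1) by (auto simp: has_value_def)
  have "F * fps_of_poly (q * (1 - monom 1 c)) = fps_of_poly p"
    by (simp add: fps_of_poly_mult fps_of_poly_diff fps_of_poly_monom' flip: 1)
  then show ?thesis
    by (rule has_valueI) (use 1 assms(2) in auto)
qed

lemma ev_denominator_eq_0:
  assumes "has_value z ((1 - fps_X ^ k) * F) v" "v \<noteq> 0" "z ^ k = 1"
    and "F * fps_of_poly q = fps_of_poly p"
  shows "ev z q = 0"
proof -
  obtain p' q' where 1: "(1 - fps_X ^ k) * F * fps_of_poly q' = fps_of_poly p'" "ev z q' \<noteq> 0"
    "v = ev z p' / ev z q'"
    using assms(1) by (auto simp: has_value_def)
  have "fps_of_poly ((1 - monom 1 k) * p * q') = fps_of_poly (p' * q)"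
    by (simp add: fps_of_poly_mult fps_of_poly_diff fps_of_poly_monom' flip: 1(1) assms(4))
  then have "(1 - monom 1 k) * p * q' = p' * q"
    by (simp only: fps_of_poly_eq_iff)
  then have "ev z ((1 - monom 1 k) * p * q') = ev z (p' * q)" by simp
  then show ?thesis using 1 assms(2,3) by auto
qed

lemma lowest_terms_exists:
  fixes F :: "rat fps"
  assumes "F * fps_of_poly q = fps_of_poly p" "q \<noteq> 0"
  shows "\<exists>p q. lowest_terms F p q"
proof -
  obtain p' q' where pq: "p = p' * gcd p q" "q = q' * gcd p q" "coprime p' q'"
    using gcd_coprime_exists[of p q] assms(2) by auto
  have "F * fps_of_poly q' * fps_of_poly (gcd p q) = fps_of_poly p' * fps_of_poly (gcd p q)"
    using assms(1) pq(1,2) by (metis fps_of_poly_mult mult.assoc)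
  then have "F * fps_of_poly q' = fps_of_poly p'"
    using assms(2) by simp
  then show ?thesis
    unfolding lowest_terms_def using pq assms(2) by (intro exI[of _ p'] exI[of _ q']) auto
qed

lemma has_value_imp_lowest_terms:
  assumes "has_value z ((1 - fps_X ^ k) * F) v" "k > 0"
  shows "\<exists>p q. lowest_terms F p q"
proof -
  obtain p q where 1: "(1 - fps_X ^ k) * F * fps_of_poly q = fps_of_poly p" "ev z q \<noteq> 0"
    using assms(1) by (auto simp: has_value_def)
  have "F * fps_of_poly ((1 - monom 1 k) * q) = fps_of_poly p"
    by (simp add: fps_of_poly_mult fps_of_poly_diff fps_of_poly_monom' flip: 1(1))
  moreover have "1 - monom (1::rat) k \<noteq> 0"
    using assms(2) by (metis eq_iff_diff_eq_0 degree_1 degree_monom_eq one_neq_zero less_irrefl)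
  ultimately show ?thesis
    using 1(2) by (intro lowest_terms_exists[of F "(1 - monom 1 k) * q" p]) auto
qed

lemma no_double_root_one_minus_monom:
  assumes "p * q dvd 1 - monom 1 n" "n > 0" "ev z p = 0" "ev z q = 0"
  shows False
proof -
  obtain r where r: "1 - monom 1 n = p * q * r" using assms(1) by auto
  have "pderiv (1 - monom (1::rat) n) = - monom (of_nat n) (n - 1)"
    by (simp add: pderiv_diff pderiv_monom)
  then have "- monom (of_nat n) (n - 1) = p * pderiv (q * r) + q * r * pderiv p"
    unfolding r by (simp add: pderiv_mult mult.assoc algebra_simps)
  then have "ev z (- monom (of_nat n) (n - 1)) = ev z (p * pderiv (q * r) + q * r * pderiv p)"
    by (rule arg_cong)
  then have "z ^ (n - 1) = 0" using assms by (simp add: ev_prod)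
  then have "z = 0" by simp
  moreover have "ev z (1 - monom 1 n) = 0" unfolding r using assms by simp
  ultimately show False using assms(2) by (simp add: zero_power)
qed

definition primitive_root :: "nat \<Rightarrow> complex \<Rightarrow> bool" where
  "primitive_root k z \<longleftrightarrow> z ^ k = 1 \<and> (\<forall>d. 0 < d \<and> d < k \<longrightarrow> z ^ d \<noteq> 1)"

lemma Psi_root_primitive:
  assumes "k > 0" "ev z (Psi k) = 0"
  shows "primitive_root k z"
proof -
  have fin: "finite {d. d dvd n}" if "n > 0" for n :: nat
    using that by simp
  have "Psi k dvd 1 - monom 1 k"
    unfolding prod_Psi[OF assms(1), symmetric] by (rule dvd_prodI) (use fin assms in auto)
  then have zk: "z ^ k = 1" using ev_dvd[OF _ assms(2)] by fastforce
  have False if d: "0 < d" "d < k" "z ^ d = 1" for d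
  proof -
    define g where "g = gcd d k"
    obtain x y where xy: "d * x = k * y + g"
      using bezout_nat[of d k] d(1) by (auto simp: g_def)
    have "z ^ (d * x) = z ^ (k * y) * z ^ g" by (simp add: xy power_add)
    then have zg: "z ^ g = 1" by (simp add: power_mult d zk)
    have g: "g > 0" "g dvd k" "g < k"
      using d by (auto simp: g_def intro: le_less_trans[OF gcd_le1_nat])
    have "ev z (\<Prod>e | e dvd g. Psi e) = 0" by (simp add: prod_Psi[OF g(1)] zg)
    then obtain e where e: "e dvd g" "ev z (Psi e) = 0"
      using fin[OF g(1)] by (auto simp: ev_prod)
    have "e \<noteq> k" using e(1) g by (auto dest: dvd_imp_le)
    then have "Psi e * Psi k = (\<Prod>c\<in>{e, k}. Psi c)" by simp
    also have "\<dots> dvd (\<Prod>c | c dvd k. Psi c)"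
      by (rule prod_dvd_prod_subset) (use fin assms e g in \<open>auto intro: dvd_trans\<close>)
    finally have "Psi e * Psi k dvd 1 - monom 1 k" using prod_Psi[OF assms(1)] by simp
    then show False using no_double_root_one_minus_monom e(2) assms by blast
  qed
  with zk show ?thesis by (auto simp: primitive_root_def)
qed

lemma nonconstant_has_root:
  assumes "degree p > 0"
  obtains z where "ev z p = 0"
proof -
  have "degree (map_poly of_rat p :: complex poly) = degree p"
    by (simp add: degree_map_poly)
  then have "\<not> constant (poly (map_poly of_rat p :: complex poly))"
    using assms by (simp add: constant_degree)
  then obtain z where "poly (map_poly of_rat p :: complex poly) z = 0"
    using fundamental_theorem_of_algebra by blast
  then show ?thesis using that by (simp add: ev_def)
qed

lemma Psi_dvdI:
  assumes "k > 0" "\<And>z. ev z (Psi k) = 0 \<Longrightarrow> ev z q = 0"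
  shows "Psi k dvd q"
proof -
  have dvd: "Psi k dvd 1 - monom 1 k"
    unfolding prod_Psi[OF assms(1), symmetric] by (rule dvd_prodI) (use assms in auto)
  obtain r where r: "Psi k = gcd (Psi k) q * r" by (meson dvdE gcd_dvd1)
  have "degree r = 0"
  proof (rule ccontr)
    assume "degree r \<noteq> 0"
    then obtain z where z: "ev z r = 0" using nonconstant_has_root by blast
    then have Pz: "ev z (Psi k) = 0" by (subst r) simp
    obtain u v where "u * Psi k + v * q = gcd (Psi k) q" using bezout_coefficients_fst_snd by blast
    then have "ev z (gcd (Psi k) q) = ev z (u * Psi k + v * q)" by simp
    also have "\<dots> = 0" using Pz assms(2)[OF Pz] by simp
    finally show False
      using no_double_root_one_minus_monom[of "gcd (Psi k) q" r k z] z dvd assms(1)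
      by (simp flip: r)
  qed
  moreover have "1 - monom (1::rat) k \<noteq> 0"
    using assms(1) by (metis eq_iff_diff_eq_0 degree_1 degree_monom_eq one_neq_zero less_irrefl)
  then have "Psi k \<noteq> 0" using dvd by auto
  then have "r \<noteq> 0" using r by auto
  ultimately have "is_unit r" by (simp add: is_unit_iff_degree)
  then have "Psi k dvd gcd (Psi k) q" using r by (metis dvd_refl mult_unit_dvd_iff)
  then show ?thesis by simp
qed

lemma is_pole_rational:
  assumes "coprime p q" "q \<noteq> 0" "ev z q = 0"
  shows "is_pole (\<lambda>w. poly (map_poly of_rat p) w / poly (map_poly of_rat q) w) z"
proof -
  obtain u v where "u * p + v * q = 1"
    using assms(1) by (metis bezout_coefficients_fst_snd coprime_iff_gcd_eq_1)
  then have "ev z (u * p + v * q) = 1" by simp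
  then have p: "poly (map_poly of_rat p) z \<noteq> 0" using assms(3) by (auto simp: ev_def[symmetric])
  have q0: "map_poly of_rat q \<noteq> (0 :: complex poly)"
    using assms(2) by (simp add: map_poly_eq_0_iff)
  have "filterlim (poly (map_poly of_rat q)) (at 0) (at z)"
  proof (rule filterlim_atI)
    have "(poly (map_poly of_rat q) \<longlongrightarrow> poly (map_poly of_rat q) z) (at z)"
      by (intro tendsto_intros)
    then show "(poly (map_poly of_rat q) \<longlongrightarrow> 0) (at z)" using assms(3) by (simp add: ev_def)
    have "finite {w :: complex. poly (map_poly of_rat q) w = 0}" using q0 by (rule poly_roots_finite)
    then have "\<forall>\<^sub>F w in at z. w \<notin> {w :: complex. poly (map_poly of_rat q) w = 0}"
      using islimpt_finite islimpt_iff_eventually by blast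
    then show "\<forall>\<^sub>F w in at z. poly (map_poly of_rat q) w \<noteq> 0" by simp
  qed
  moreover have "isCont (poly (map_poly of_rat p)) z" by simp
  ultimately show ?thesis using is_pole_divide[of z "poly (map_poly of_rat p)"] p by simp
qed

lemma primitive_root_exists:
  assumes "k > 0"
  obtains z where "primitive_root k z"
proof
  let ?z = "exp (2 * of_real pi * \<i> * of_nat 1 / of_nat k)"
  have "?z ^ d \<noteq> 1" if "0 < d" "d < k" for d
  proof
    assume "?z ^ d = 1"
    then have "exp (2 * of_real pi * \<i> * of_nat d / of_nat k) = 1"
      by (simp add: field_simps flip: exp_of_nat_mult)
    then have "d mod k = 0 mod k"
      using complex_root_unity_eq[of k d 0] assms by (simp add: cong_def)
    then show False using that by simp
  qed
  moreover have "?z ^ k = 1" using complex_root_unity[of k 1] assms by simp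
  ultimately show "primitive_root k ?z" by (auto simp: primitive_root_def)
qed

section \<open>Configurations in the quadrant and their generating functions\<close>

definition wgf :: "'a set \<Rightarrow> ('a \<Rightarrow> nat) \<Rightarrow> rat fps" where
  "wgf S w = Abs_fps (\<lambda>m. of_nat (card {z\<in>S. w z = m}))"

definition finite_fibres :: "'a set \<Rightarrow> ('a \<Rightarrow> nat) \<Rightarrow> bool" where
  "finite_fibres S w \<longleftrightarrow> (\<forall>m. finite {z\<in>S. w z = m})"

lemma wgf_nth: "fps_nth (wgf S w) m = of_nat (card {z\<in>S. w z = m})"
  by (simp add: wgf_def)

lemma wgf_bij:
  assumes "bij_betw f S T" "\<And>z. z \<in> S \<Longrightarrow> v (f z) = w z"
  shows "wgf S w = wgf T v"
proof -
  have "card {z\<in>S. w z = m} = card {y\<in>T. v y = m}" for m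
    by (rule bij_betw_same_card[of f])
      (use assms in \<open>auto simp: bij_betw_def inj_on_def\<close>)
  then show ?thesis by (simp add: wgf_def)
qed

lemma wgf_add_const: "wgf S (\<lambda>z. c + w z) = fps_X ^ c * wgf S w"
proof (rule fps_ext)
  fix m
  have "{z\<in>S. c + w z = m} = (if m < c then {} else {z\<in>S. w z = m - c})" by auto
  then show "fps_nth (wgf S (\<lambda>z. c + w z)) m = fps_nth (fps_X ^ c * wgf S w) m"
    by (simp add: wgf_nth fps_X_power_mult_nth)
qed

lemma wgf_Sigma_nth:
  assumes "finite I" "\<And>i. i \<in> I \<Longrightarrow> finite_fibres (S i) (w i)"
  shows "of_nat (card {z\<in>Sigma I S. w (fst z) (snd z) = m}) = (\<Sum>i\<in>I. fps_nth (wgf (S i) (w i)) m)"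
proof -
  have "{z\<in>Sigma I S. w (fst z) (snd z) = m} = Sigma I (\<lambda>i. {z\<in>S i. w i z = m})" by auto
  then show ?thesis
    using assms by (simp add: wgf_nth finite_fibres_def)
qed

lemma wgf_Sigma:
  assumes "finite I" "\<And>i. i \<in> I \<Longrightarrow> finite_fibres (S i) (w i)"
  shows "wgf (Sigma I S) (\<lambda>z. w (fst z) (snd z)) = (\<Sum>i\<in>I. wgf (S i) (w i))"
  by (rule fps_ext) (unfold wgf_nth[of "Sigma I S"] fps_sum_nth, rule wgf_Sigma_nth[OF assms])

lemma wgf_Times:
  assumes "finite_fibres S w" "finite_fibres T v"
  shows "wgf (S \<times> T) (\<lambda>z. w (fst z) + v (snd z)) = wgf S w * wgf T v"
proof (rule fps_ext)
  fix m
  let ?X = "\<lambda>i. {a\<in>S. w a = i} \<times> {b\<in>T. v b = m - i}"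
  have "card {z\<in>S \<times> T. w (fst z) + v (snd z) = m} = card (\<Union>i\<in>{0..m}. ?X i)"
    by (rule arg_cong[of _ _ card]) auto
  also have "\<dots> = (\<Sum>i=0..m. card (?X i))"
    by (rule card_UN_disjoint) (use assms in \<open>auto simp: finite_fibres_def\<close>)
  finally show "fps_nth (wgf (S \<times> T) (\<lambda>z. w (fst z) + v (snd z))) m = fps_nth (wgf S w * wgf T v) m"
    by (simp add: wgf_nth fps_mult_nth card_cartesian_product)
qed

type_synonym cell = "nat \<times> nat"

text \<open>
  A pair \<open>(h, s)\<close> records the bonds of a configuration in the quadrant: \<open>(i, j) \<in> h\<close> is the
  horizontal bond from \<open>(i, j)\<close> to \<open>(i + 1, j)\<close>, and \<open>(i, j) \<in> s\<close> the vertical bond from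
  \<open>(i, j)\<close> to \<open>(i, j + 1)\<close>.  Directedness is the local condition that every bond starts at a
  source in \<open>S\<close> or at the end point of another bond.
\<close>

definition present :: "cell set \<Rightarrow> cell set \<Rightarrow> cell set \<Rightarrow> cell \<Rightarrow> bool" where
  "present S h s c \<longleftrightarrow> (case c of (i, j) \<Rightarrow>
     (i, j) \<in> S \<or> (\<exists>i'. i = Suc i' \<and> (i', j) \<in> h) \<or> (\<exists>j'. j = Suc j' \<and> (i, j') \<in> s))"

definition configs :: "cell set \<Rightarrow> (cell set \<times> cell set) set" where
  "configs S = {(h, s). finite h \<and> finite s \<and> (\<forall>c\<in>h \<union> s. present S h s c)}"

lemma configs_converse: "(s\<inverse>, h\<inverse>) \<in> configs (S\<inverse>) \<longleftrightarrow> (h, s) \<in> configs S"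
  unfolding configs_def present_def by (auto 0 4)

lemma configs_col_bound:
  assumes "(h, s) \<in> configs S" "S \<subseteq> {..c} \<times> UNIV" "(i, j) \<in> h \<union> s"
  shows "i \<le> c + card {p\<in>h. fst p < i}"
  using assms(3)
proof (induction "i + j" arbitrary: i j rule: less_induct)
  case less
  have "finite h" using assms(1) by (simp add: configs_def)
  have "present S h s (i, j)" using assms(1) less.prems by (auto simp: configs_def)
  then consider "(i, j) \<in> S" | i' where "i = Suc i'" "(i', j) \<in> h" | j' where "j = Suc j'" "(i, j') \<in> s"
    by (auto simp: present_def)
  then show ?case
  proof cases
    case 1
    then show ?thesis using assms(2) by auto
  next
    case (2 i')
    then have "i' \<le> c + card {p\<in>h. fst p < i'}" using less.hyps[of i' j] by simp
    moreover have "card {p\<in>h. fst p < i'} < card {p\<in>h. fst p < i}"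
      using \<open>finite h\<close> 2 by (intro psubset_card_mono) force+
    ultimately show ?thesis using 2 by simp
  next
    case (3 j')
    then show ?thesis using less.hyps[of i j'] by simp
  qed
qed

lemma configs_row_bound:
  assumes "(h, s) \<in> configs S" "S \<subseteq> UNIV \<times> {..d}" "(i, j) \<in> h \<union> s"
  shows "j \<le> d + card {p\<in>s. snd p < j}"
proof -
  have "j \<le> d + card {p\<in>s\<inverse>. fst p < j}"
    by (rule configs_col_bound[of _ "h\<inverse>" "S\<inverse>" _ _ i])
      (use assms in \<open>auto simp: configs_converse\<close>)
  also have "{p\<in>s\<inverse>. fst p < j} = {p\<in>s. snd p < j}\<inverse>" by auto
  finally show ?thesis by simp
qed

definition rows :: "cell set \<Rightarrow> nat multiset" where
  "rows s = image_mset snd (mset_set s)"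

lemma size_rows [simp]: "size (rows s) = card s"
  by (simp add: rows_def)

lemma set_rows [simp]: "finite s \<Longrightarrow> set_mset (rows s) = snd ` s"
  by (simp add: rows_def)

definition row_configs :: "cell set \<Rightarrow> nat multiset \<Rightarrow> (cell set \<times> cell set) set" where
  "row_configs S M = {z\<in>configs S. rows (snd z) = M}"

definition hcard :: "cell set \<times> cell set \<Rightarrow> nat" where
  "hcard z = card (fst z)"

lemma hcard_simp [simp]: "hcard (h, s) = card h"
  by (simp add: hcard_def)

lemma finite_fibres_configs:
  assumes "finite S"
  shows "finite_fibres (row_configs S M) hcard"
proof -
  obtain c where c: "\<And>p. p \<in> S \<Longrightarrow> fst p \<le> c"
    using finite_nat_set_iff_bounded_le[of "fst ` S"] assms by auto
  obtain d where d: "\<And>p. p \<in> S \<Longrightarrow> snd p \<le> d"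
    using finite_nat_set_iff_bounded_le[of "snd ` S"] assms by auto
  have sub: "h \<union> s \<subseteq> {..c + card h} \<times> {..d + card s}" if hs: "(h, s) \<in> configs S" for h s
  proof (rule subrelI)
    fix i j assume ij: "(i, j) \<in> h \<union> s"
    have fin: "finite h" "finite s" using hs by (auto simp: configs_def)
    have "i \<le> c + card {p\<in>h. fst p < i}"
      by (rule configs_col_bound[OF hs _ ij]) (use c in force)
    also have "card {p\<in>h. fst p < i} \<le> card h" using fin by (intro card_mono) auto
    finally have "i \<le> c + card h" by simp
    have "j \<le> d + card {p\<in>s. snd p < j}"
      by (rule configs_row_bound[OF hs _ ij]) (use d in force)
    also have "card {p\<in>s. snd p < j} \<le> card s" using fin by (intro card_mono) auto
    finally have "j \<le> d + card s" by simp
    with \<open>i \<le> c + card h\<close> show "(i, j) \<in> {..c + card h} \<times> {..d + card s}" by simp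
  qed
  have "finite {z\<in>row_configs S M. hcard z = m}" for m
  proof (rule finite_subset)
    let ?X = "Pow ({..c + m} \<times> {..d + size M})"
    show "finite (?X \<times> ?X)" by simp
    show "{z\<in>row_configs S M. hcard z = m} \<subseteq> ?X \<times> ?X"
      using sub by (fastforce simp: row_configs_def)
  qed
  then show ?thesis by (simp add: finite_fibres_def)
qed

definition head :: "cell set \<Rightarrow> nat set" where "head h = {j. (0, j) \<in> h}"
definition tail :: "cell set \<Rightarrow> cell set" where "tail h = {(i, j). (Suc i, j) \<in> h}"
definition join :: "nat set \<Rightarrow> cell set \<Rightarrow> cell set" where
  "join A h = {(i, j). case i of 0 \<Rightarrow> j \<in> A | Suc i' \<Rightarrow> (i', j) \<in> h}"

lemma in_join [simp]:
  "(0, j) \<in> join A h \<longleftrightarrow> j \<in> A" "(Suc i, j) \<in> join A h \<longleftrightarrow> (i, j) \<in> h"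
  by (simp_all add: join_def)

lemma in_head [simp]: "j \<in> head h \<longleftrightarrow> (0, j) \<in> h"
  by (simp add: head_def)

lemma in_tail [simp]: "(i, j) \<in> tail h \<longleftrightarrow> (Suc i, j) \<in> h"
  by (simp add: tail_def)

lemma head_join [simp]: "head (join A h) = A" and tail_join [simp]: "tail (join A h) = h"
  by auto

lemma join_head_tail [simp]: "join (head h) (tail h) = h"
proof -
  have "(i, j) \<in> join (head h) (tail h) \<longleftrightarrow> (i, j) \<in> h" for i j by (cases i) auto
  then show ?thesis by auto
qed

lemma join_eq: "join A h = Pair 0 ` A \<union> map_prod Suc id ` h"
proof -
  have "(i, j) \<in> join A h \<longleftrightarrow> (i, j) \<in> Pair 0 ` A \<union> map_prod Suc id ` h" for i j
    by (cases i) force+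
  then show ?thesis by auto
qed

lemma inj_shift: "inj_on (map_prod Suc id) (h :: cell set)"
  by (auto simp: inj_on_def)

lemma finite_join [simp]: "finite (join A h) \<longleftrightarrow> finite A \<and> finite h"
  by (auto simp: join_eq finite_image_iff[OF inj_shift] finite_image_iff inj_on_def)

lemma card_join [simp]:
  assumes "finite A" "finite h"
  shows "card (join A h) = card A + card h"
proof -
  have "card (join A h) = card (Pair (0::nat) ` A) + card (map_prod Suc id ` h)"
    unfolding join_eq using assms by (intro card_Un_disjoint) auto
  then show ?thesis by (simp add: card_image[OF inj_shift] card_image inj_on_def)
qed

lemma rows_join [simp]:
  assumes "finite B" "finite s"
  shows "rows (join B s) = mset_set B + rows s"
proof -
  have "mset_set (join B s) = mset_set (Pair 0 ` B) + mset_set (map_prod Suc id ` s)"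
    unfolding join_eq using assms by (intro mset_set_Union) auto
  also have "\<dots> = image_mset (Pair 0) (mset_set B) + image_mset (map_prod Suc id) (mset_set s)"
    by (simp add: image_mset_mset_set[OF inj_shift] image_mset_mset_set inj_on_def)
  finally show ?thesis by (simp add: rows_def image_mset.compositionality comp_def)
qed

lemma configs_join:
  "(join A h, join B s) \<in> configs S \<longleftrightarrow>
     finite A \<and> finite B \<and> A \<union> B \<subseteq> head S \<union> Suc ` B \<and> (h, s) \<in> configs (tail S \<union> {0} \<times> A)"
proof -
  have 0: "present S (join A h) (join B s) (0, j) \<longleftrightarrow> j \<in> head S \<union> Suc ` B" for j
    by (auto simp: present_def)
  have 1: "present S (join A h) (join B s) (Suc i, j) \<longleftrightarrow> present (tail S \<union> {0} \<times> A) h s (i, j)" for i j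
    by (cases i) (auto simp: present_def)
  have "(\<forall>c\<in>join A h \<union> join B s. present S (join A h) (join B s) c) \<longleftrightarrow>
    (\<forall>j\<in>A \<union> B. j \<in> head S \<union> Suc ` B) \<and> (\<forall>c\<in>h \<union> s. present (tail S \<union> {0} \<times> A) h s c)"
  proof -
    have "(\<forall>c\<in>join A h \<union> join B s. present S (join A h) (join B s) c) \<longleftrightarrow>
      (\<forall>i j. (i, j) \<in> join A h \<union> join B s \<longrightarrow> present S (join A h) (join B s) (i, j))" by auto
    also have "\<dots> \<longleftrightarrow> (\<forall>j. (0, j) \<in> join A h \<union> join B s \<longrightarrow> present S (join A h) (join B s) (0, j)) \<and>
      (\<forall>i j. (Suc i, j) \<in> join A h \<union> join B s \<longrightarrow> present S (join A h) (join B s) (Suc i, j))"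
      by (metis not0_implies_Suc)
    finally show ?thesis unfolding 0 1 by auto
  qed
  then show ?thesis unfolding configs_def by auto
qed

lemma mset_set_le_iff: "finite B \<Longrightarrow> mset_set B \<subseteq># M \<longleftrightarrow> B \<subseteq> set_mset M"
  by (auto simp: subseteq_mset_def count_mset_set' Suc_le_eq subset_eq)

text \<open>
  Here \<open>A\<close> is the set of rows met by a vertical cut, and \<open>M\<close> counts, row by row, the vertical bonds
  to the right of the cut.
\<close>

definition completion_gf :: "nat set \<Rightarrow> nat multiset \<Rightarrow> rat fps" where
  "completion_gf A M = wgf (row_configs ({0} \<times> A) M) hcard"

definition steps :: "nat set \<Rightarrow> nat multiset \<Rightarrow> (nat set \<times> nat set) set" where
  "steps A M = {(B, A'). B \<subseteq> set_mset M \<and> B \<union> A' \<subseteq> A \<union> Suc ` B}"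

lemma finite_steps: "finite A \<Longrightarrow> finite (steps A M)"
proof (rule finite_subset)
  assume "finite A"
  then show "finite (Pow (set_mset M) \<times> Pow (A \<union> Suc ` set_mset M))" by simp
  show "steps A M \<subseteq> Pow (set_mset M) \<times> Pow (A \<union> Suc ` set_mset M)"
    unfolding steps_def by blast
qed

lemma completion_gf_rec:
  assumes "finite A"
  shows "completion_gf A M = (\<Sum>(B, A')\<in>steps A M. fps_X ^ card A' * completion_gf A' (M - mset_set B))"
proof -
  define T where "T = (\<lambda>(B, A'). row_configs ({0} \<times> A') (M - mset_set B))"
  define f where "f = (\<lambda>((B, A'), (h, s)). (join A' h, join B s))"
  define w where "w = (\<lambda>(B :: nat set, A' :: nat set) z. card A' + hcard z)"
  have finB: "finite B" "finite A'" if "(B, A') \<in> steps A M" for B A'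
    using that assms by (auto simp: steps_def intro: finite_subset[OF _ finite_set_mset] finite_subset)
  have iff: "(join A' h, join B s) \<in> row_configs ({0} \<times> A) M \<longleftrightarrow>
    (B, A') \<in> steps A M \<and> (h, s) \<in> row_configs ({0} \<times> A') (M - mset_set B)" for A' B h s
  proof (cases "finite A' \<and> finite B \<and> finite h \<and> finite s")
    case True
    have "head ({0} \<times> A) = A" "tail ({0} \<times> A) = {}" by auto
    moreover have "mset_set B + rows s = M \<longleftrightarrow> B \<subseteq> set_mset M \<and> rows s = M - mset_set B"
      using True by (auto simp flip: mset_set_le_iff)
    ultimately show ?thesis
      using True by (auto simp: row_configs_def configs_join steps_def)
  next
    case False
    then show ?thesis using finB by (auto simp: row_configs_def configs_def)
  qed
  have bij: "bij_betw f (Sigma (steps A M) T) (row_configs ({0} \<times> A) M)"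
  proof (rule bij_betwI[where g = "\<lambda>(h, s). ((head s, head h), (tail h, tail s))"])
    show "f \<in> Sigma (steps A M) T \<rightarrow> row_configs ({0} \<times> A) M"
      by (auto simp: f_def T_def iff)
    show "(\<lambda>(h, s). ((head s, head h), (tail h, tail s))) \<in> row_configs ({0} \<times> A) M \<rightarrow> Sigma (steps A M) T"
    proof
      fix z assume z: "z \<in> row_configs ({0} \<times> A) M"
      obtain h s where [simp]: "z = (h, s)" by (cases z)
      show "(\<lambda>(h, s). ((head s, head h), (tail h, tail s))) z \<in> Sigma (steps A M) T"
        using z iff[of "head h" "tail h" "head s" "tail s"] by (simp add: T_def)
    qed
  qed (auto simp: f_def)
  have "completion_gf A M = wgf (Sigma (steps A M) T) (\<lambda>z. w (fst z) (snd z))"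
    unfolding completion_gf_def
  proof (rule wgf_bij[OF bij, symmetric])
    fix z assume "z \<in> Sigma (steps A M) T"
    then obtain B A' h s where z: "z = ((B, A'), (h, s))" "(B, A') \<in> steps A M"
      "(h, s) \<in> row_configs ({0} \<times> A') (M - mset_set B)" by (auto simp: T_def)
    then show "hcard (f z) = w (fst z) (snd z)"
      using finB[OF z(2)] by (simp add: f_def w_def row_configs_def configs_def)
  qed
  also have "\<dots> = (\<Sum>i\<in>steps A M. wgf (T i) (w i))"
  proof (rule wgf_Sigma)
    show "finite (steps A M)" using assms by (rule finite_steps)
    fix i assume i: "i \<in> steps A M"
    obtain B A' where [simp]: "i = (B, A')" by (cases i)
    have "finite_fibres (T i) hcard"
      using finB i unfolding T_def by (auto intro!: finite_fibres_configs)
    then have fin: "finite {z\<in>T i. hcard z = m - card A'}" for m by (simp add: finite_fibres_def)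
    have "finite {z\<in>T i. card A' + hcard z = m}" for m
      by (rule finite_subset[OF _ fin[of m]]) auto
    then show "finite_fibres (T i) (w i)"
      by (simp add: finite_fibres_def w_def)
  qed
  also have "\<dots> = (\<Sum>(B, A')\<in>steps A M. fps_X ^ card A' * completion_gf A' (M - mset_set B))"
    by (intro sum.cong) (auto simp: w_def T_def completion_gf_def wgf_add_const)
  finally show ?thesis .
qed

lemma configs_empty: "configs {} = {({}, {})}"
proof -
  have False if hs: "(h, s) \<in> configs {}" and "(i, j) \<in> h \<union> s" for h s i j
    using that(2)
  proof (induction "i + j" arbitrary: i j rule: less_induct)
    case less
    have "present {} h s (i, j)" using hs less.prems by (auto simp: configs_def)
    then show ?case
      using less.hyps[of "i - 1" j] less.hyps[of i "j - 1"] by (auto simp: present_def)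
  qed
  then have "h = {} \<and> s = {}" if "(h, s) \<in> configs {}" for h s using that by fast
  then show ?thesis by (auto simp: configs_def)
qed

lemma completion_gf_empty: "completion_gf {} M = (if M = {#} then 1 else 0)"
proof (rule fps_ext)
  fix m
  have "{z\<in>row_configs {} M. hcard z = m} = (if M = {#} \<and> m = 0 then {({}, {})} else {})"
    by (auto simp: row_configs_def configs_empty rows_def)
  then show "fps_nth (completion_gf {} M) m = fps_nth (if M = {#} then 1 else 0) m"
    by (simp add: completion_gf_def wgf_nth)
qed

section \<open>Poles coming from the left of a cut\<close>

lemma stepsD:
  assumes "finite A" "(B, A') \<in> steps A M"
  shows "finite B" "finite A'" "size (M - mset_set B) + card B = size M"
    "card A' \<le> card A + card B"
proof -
  have B: "B \<subseteq> set_mset M" "A' \<subseteq> A \<union> Suc ` B" using assms(2) by (auto simp: steps_def)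
  then show "finite B" using finite_subset by auto
  then show "finite A'" using assms(1) B by (auto intro: finite_subset)
  have "mset_set B \<subseteq># M" using \<open>finite B\<close> B by (simp add: mset_set_le_iff)
  then show "size (M - mset_set B) + card B = size M"
    using size_mset_mono[of "mset_set B" M] by (simp add: size_Diff_submset)
  have "card A' \<le> card (A \<union> Suc ` B)"
    using assms(1) B \<open>finite B\<close> by (intro card_mono) auto
  also have "\<dots> \<le> card A + card (Suc ` B)" by (rule card_Un_le)
  finally show "card A' \<le> card A + card B" by (simp add: card_image)
qed

lemma steps_measure:
  assumes "finite A" "(B, A') \<in> steps A M - {({}, A)}"
  shows "2 * size (M - mset_set B) + card A' < 2 * size M + card A"
proof (cases "B = {}")
  case True
  then have "A' \<subset> A" using assms(2) by (auto simp: steps_def)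
  then show ?thesis using True assms(1) psubset_card_mono by simp
next
  case False
  then have "card B > 0" using stepsD(1)[of A B A' M] assms by (simp add: card_gt_0_iff)
  then show ?thesis using stepsD(3,4)[of A B A' M] assms by simp
qed

lemma sum_steps:
  assumes "finite A"
  shows "(\<Sum>x\<in>steps A M. f x) = f ({}, A) + (\<Sum>x\<in>steps A M - {({}, A)}. f x)"
  by (rule sum.remove) (use assms finite_steps in \<open>auto simp: steps_def\<close>)

lemma completion_gf_rec':
  assumes "finite A"
  shows "(1 - fps_X ^ card A) * completion_gf A M =
    (\<Sum>(B, A')\<in>steps A M - {({}, A)}. fps_X ^ card A' * completion_gf A' (M - mset_set B))"
proof -
  have "completion_gf A M = fps_X ^ card A * completion_gf A M +
    (\<Sum>(B, A')\<in>steps A M - {({}, A)}. fps_X ^ card A' * completion_gf A' (M - mset_set B))"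
    by (subst completion_gf_rec[OF assms], subst sum_steps[OF assms]) simp
  then show ?thesis by (simp add: algebra_simps)
qed

lemma one_minus_X_power_neq_0:
  assumes "c > 0"
  shows "1 - fps_X ^ c \<noteq> (0 :: rat fps)"
proof -
  have "fps_nth (1 - fps_X ^ c :: rat fps) 0 = 1" using assms by (simp add: fps_X_power_nth)
  then show ?thesis by (metis fps_zero_nth zero_neq_one)
qed

lemma bij_betw_steps_split:
  assumes "j \<notin># M"
  shows "bij_betw (\<lambda>(B, A'). ((B \<inter> {..j}, A' \<inter> {..j}), (B \<inter> {j<..}, A' \<inter> {j<..}))) (steps A M)
    (steps (A \<inter> {..j}) (filter_mset (\<lambda>i. i \<le> j) M) \<times> steps (A \<inter> {j<..}) (filter_mset (\<lambda>i. j < i) M))"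
    (is "bij_betw ?f _ (?S1 \<times> ?S2)")
proof (rule bij_betwI[where g = "\<lambda>((B1, A1), (B2, A2)). (B1 \<union> B2, A1 \<union> A2)"])
  show "?f \<in> steps A M \<rightarrow> ?S1 \<times> ?S2"
  proof
    fix x assume x: "x \<in> steps A M"
    obtain B A' where x_eq: "x = (B, A')" by (cases x)
    have B: "B \<subseteq> set_mset M" "B \<union> A' \<subseteq> A \<union> Suc ` B" using x by (auto simp: x_eq steps_def)
    have "j \<notin> B" using B assms by auto
    have lo: "Suc ` B \<inter> {..j} \<subseteq> Suc ` (B \<inter> {..j})" by auto
    have hi: "Suc ` B \<inter> {j<..} \<subseteq> Suc ` (B \<inter> {j<..})"
    proof
      fix y assume "y \<in> Suc ` B \<inter> {j<..}"
      then obtain b where "y = Suc b" "b \<in> B" "j \<le> b" by auto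
      then show "y \<in> Suc ` (B \<inter> {j<..})" using \<open>j \<notin> B\<close> by (cases "b = j") auto
    qed
    have "(B \<union> A') \<inter> {..j} \<subseteq> A \<inter> {..j} \<union> Suc ` (B \<inter> {..j})"
      "(B \<union> A') \<inter> {j<..} \<subseteq> A \<inter> {j<..} \<union> Suc ` (B \<inter> {j<..})"
      using B(2) lo hi by blast+
    then have "(B \<inter> {..j}, A' \<inter> {..j}) \<in> ?S1" "(B \<inter> {j<..}, A' \<inter> {j<..}) \<in> ?S2"
      using B(1) by (auto simp: steps_def Int_Un_distrib2)
    then show "?f x \<in> ?S1 \<times> ?S2" by (simp add: x_eq)
  qed
  have S1: "B \<subseteq> {..<j} \<and> A' \<subseteq> {..j}" if "(B, A') \<in> ?S1" for B A'
  proof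
    show "B \<subseteq> {..<j}"
    proof
      fix b assume "b \<in> B"
      then have "b \<in># M" "b \<le> j" using that by (auto simp: steps_def)
      then show "b \<in> {..<j}" using assms by (cases "b = j") auto
    qed
    then show "A' \<subseteq> {..j}" using that by (fastforce simp: steps_def)
  qed
  have S2: "B \<subseteq> {j<..} \<and> A' \<subseteq> {j<..}" if "(B, A') \<in> ?S2" for B A'
    using that by (fastforce simp: steps_def)
  show "(\<lambda>((B1, A1), (B2, A2)). (B1 \<union> B2, A1 \<union> A2)) \<in> ?S1 \<times> ?S2 \<rightarrow> steps A M"
    unfolding steps_def by (auto simp: subset_iff)
  show "(\<lambda>((B1, A1), (B2, A2)). (B1 \<union> B2, A1 \<union> A2)) (?f x) = x" if "x \<in> steps A M" for x
  proof -
    have "X \<inter> {..j} \<union> X \<inter> {j<..} = X" for X by auto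
    then show ?thesis by (cases x) simp
  qed
  show "?f ((\<lambda>((B1, A1), (B2, A2)). (B1 \<union> B2, A1 \<union> A2)) y) = y" if "y \<in> ?S1 \<times> ?S2" for y
  proof -
    obtain B1 A1 B2 A2 where y: "y = ((B1, A1), (B2, A2))" by (metis surj_pair)
    have X: "(X \<union> Y) \<inter> {..j} = X \<and> (X \<union> Y) \<inter> {j<..} = Y" if "X \<subseteq> {..j}" "Y \<subseteq> {j<..}" for X Y
      using that by fastforce
    have "B1 \<subseteq> {..j}" "A1 \<subseteq> {..j}" "B2 \<subseteq> {j<..}" "A2 \<subseteq> {j<..}"
      using S1[of B1 A1] S2[of B2 A2] that y by auto
    then show ?thesis using X[of B1 B2] X[of A1 A2] by (simp add: y)
  qed
qed

text \<open>
  Rows that no vertical bond connects evolve independently; this is what removes the spurious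
  denominators \<open>1 - x ^ card A\<close> that the recursion \<open>completion_gf_rec'\<close> suggests.
\<close>

lemma completion_gf_split:
  assumes "finite A" "j \<notin># M"
  shows "completion_gf A M = completion_gf (A \<inter> {..j}) (filter_mset (\<lambda>i. i \<le> j) M) * completion_gf (A \<inter> {j<..}) (filter_mset (\<lambda>i. j < i) M)"
  using assms
proof (induction "2 * size M + card A" arbitrary: A M rule: less_induct)
  case less
  have M_split: "M = {#} \<longleftrightarrow> filter_mset (\<lambda>i. i \<le> j) M = {#} \<and> filter_mset (\<lambda>i. j < i) M = {#}" for M
  proof -
    have "filter_mset (\<lambda>i. i \<le> j) M + filter_mset (\<lambda>i. j < i) M = M"
      using multiset_partition[of M "\<lambda>i. i \<le> j"] by (simp add: not_le)
    then show ?thesis by (metis empty_eq_union)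
  qed
  show ?case
  proof (cases "A = {}")
    case True
    then show ?thesis using M_split[of M] by (auto simp: completion_gf_empty)
  next
    case False
    let ?A1 = "A \<inter> {..j}" and ?A2 = "A \<inter> {j<..}"
    let ?M1 = "\<lambda>M. filter_mset (\<lambda>i. i \<le> j) M" and ?M2 = "\<lambda>M. filter_mset (\<lambda>i. j < i) M"
    let ?t = "\<lambda>M (B, A'). fps_X ^ card A' * completion_gf A' (M - mset_set B)"
    let ?u = "\<lambda>(B, A'). fps_X ^ card A' * (completion_gf (A' \<inter> {..j}) (?M1 (M - mset_set B)) * completion_gf (A' \<inter> {j<..}) (?M2 (M - mset_set B)))"
    let ?g = "\<lambda>(x, y). ?t (?M1 M) x * ?t (?M2 M) y"
    let ?f = "\<lambda>(B, A'). ((B \<inter> {..j}, A' \<inter> {..j}), (B \<inter> {j<..}, A' \<inter> {j<..}))"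
    have "completion_gf ?A1 (?M1 M) * completion_gf ?A2 (?M2 M) =
        (\<Sum>x\<in>steps ?A1 (?M1 M). ?t (?M1 M) x) * (\<Sum>y\<in>steps ?A2 (?M2 M). ?t (?M2 M) y)"
      using completion_gf_rec[of ?A1 "?M1 M"] completion_gf_rec[of ?A2 "?M2 M"] less.prems(1) by simp
    also have "\<dots> = (\<Sum>z\<in>steps ?A1 (?M1 M) \<times> steps ?A2 (?M2 M). ?g z)"
      by (simp only: sum_product sum.cartesian_product)
    also have "\<dots> = (\<Sum>x\<in>steps A M. ?g (?f x))"
      by (rule sum.reindex_bij_betw[OF bij_betw_steps_split[OF less.prems(2)], symmetric])
    also have "\<dots> = (\<Sum>x\<in>steps A M. ?u x)"
    proof (rule sum.cong)
      fix x assume x: "x \<in> steps A M"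
      obtain B A' where x_eq: "x = (B, A')" by (cases x)
      have fin: "finite B" "finite A'" using stepsD(1,2)[OF less.prems(1)] x x_eq by blast+
      have "card A' = card (A' \<inter> {..j} \<union> A' \<inter> {j<..})"
        by (rule arg_cong[of _ _ card]) auto
      also have "\<dots> = card (A' \<inter> {..j}) + card (A' \<inter> {j<..})"
        using fin by (intro card_Un_disjoint) auto
      finally have 1: "card A' = card (A' \<inter> {..j}) + card (A' \<inter> {j<..})" .
      have 2: "?M1 (mset_set B) = mset_set (B \<inter> {..j})" "?M2 (mset_set B) = mset_set (B \<inter> {j<..})"
        using fin by (simp_all add: filter_mset_mset_set Int_def)
      show "?g (?f x) = ?u x"
        by (simp add: x_eq 1 2 power_add mult_ac)
    qed simp
    also have "\<dots> = fps_X ^ card A * (completion_gf ?A1 (?M1 M) * completion_gf ?A2 (?M2 M)) + (\<Sum>x\<in>steps A M - {({}, A)}. ?u x)"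
      by (subst sum_steps[OF less.prems(1)]) simp
    also have "(\<Sum>x\<in>steps A M - {({}, A)}. ?u x) = (\<Sum>x\<in>steps A M - {({}, A)}. ?t M x)"
    proof (rule sum.cong)
      fix x assume x: "x \<in> steps A M - {({}, A)}"
      obtain B A' where x_eq: "x = (B, A')" by (cases x)
      have fin: "finite A'" using stepsD(2)[OF less.prems(1)] x x_eq by blast
      have "j \<notin># M - mset_set B" using less.prems(2) by (meson in_diffD)
      then have "completion_gf A' (M - mset_set B) = completion_gf (A' \<inter> {..j}) (?M1 (M - mset_set B)) * completion_gf (A' \<inter> {j<..}) (?M2 (M - mset_set B))"
        using fin steps_measure[OF less.prems(1), of B A' M] x x_eq by (intro less.hyps) auto
      then show "?u x = ?t M x" by (simp add: x_eq)
    qed simp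
    also have "\<dots> = (1 - fps_X ^ card A) * completion_gf A M"
      by (rule completion_gf_rec'[OF less.prems(1), symmetric])
    finally have "(1 - fps_X ^ card A) * (completion_gf ?A1 (?M1 M) * completion_gf ?A2 (?M2 M)) = (1 - fps_X ^ card A) * completion_gf A M"
      by (simp add: algebra_simps)
    moreover have "1 - fps_X ^ card A \<noteq> (0 :: rat fps)"
      using False less.prems(1) by (intro one_minus_X_power_neq_0) (simp add: card_gt_0_iff)
    ultimately show ?thesis by simp
  qed
qed

definition regular :: "complex \<Rightarrow> rat fps \<Rightarrow> bool" where
  "regular z F \<longleftrightarrow> (\<exists>v. has_value z F v)"

lemma regularI: "has_value z F v \<Longrightarrow> regular z F"
  by (auto simp: regular_def)

lemma regular_intros:
  "regular z 1" "regular z fps_X" "regular z (fps_X ^ n)"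
  "regular z F \<Longrightarrow> regular z G \<Longrightarrow> regular z (F + G)"
  "regular z F \<Longrightarrow> regular z G \<Longrightarrow> regular z (F - G)"
  "regular z F \<Longrightarrow> regular z G \<Longrightarrow> regular z (F * G)"
  unfolding regular_def by (blast intro: has_value_intros)+

lemma regular_sum: "(\<And>i. i \<in> I \<Longrightarrow> regular z (F i)) \<Longrightarrow> regular z (\<Sum>i\<in>I. F i)"
  unfolding regular_def by (metis has_value_sum)

lemma regular_cancel: "regular z ((1 - fps_X ^ c) * F) \<Longrightarrow> z ^ c \<noteq> 1 \<Longrightarrow> regular z F"
  unfolding regular_def by (blast intro: has_value_cancel)

lemma regular_residue:
  assumes "regular z F" "z ^ k = 1"
  shows "has_value z ((1 - fps_X ^ k) * F) 0"
proof -
  obtain v where v: "has_value z F v" using assms(1) by (auto simp: regular_def)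
  have "has_value z ((1 - fps_X ^ k) * F) ((1 - z ^ k) * v)"
    by (intro has_value_intros v)
  then show ?thesis using assms(2) by simp
qed

lemma primitive_rootD:
  "primitive_root k z \<Longrightarrow> z ^ k = 1" "primitive_root k z \<Longrightarrow> 0 < d \<Longrightarrow> d < k \<Longrightarrow> z ^ d \<noteq> 1"
  by (auto simp: primitive_root_def)

text \<open>
  A cut through \<open>k\<close> rows contributes to the pole only if all of them are joined to its right,
  which takes \<open>k - 1\<close> bonds; to its left, every row outside \<open>A\<close> takes one further bond.
\<close>

lemma regular_completion_gf:
  assumes z: "primitive_root k z"
    and "finite A" "size M + card A + 1 < 2 * k \<or> size M + 1 < k"
  shows "regular z (completion_gf A M)"
  using assms(2,3)
proof (induction "2 * size M + card A" arbitrary: A M rule: less_induct)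
  case less
  consider "A = {}" | "A \<noteq> {}" "card A < k" | "k \<le> card A" by fastforce
  then show ?case
  proof cases
    case 1
    then show ?thesis by (auto simp: completion_gf_empty intro: regularI has_value_intros)
  next
    case 2
    have "regular z (fps_X ^ card A' * completion_gf A' (M - mset_set B))"
      if "(B, A') \<in> steps A M - {({}, A)}" for B A'
    proof (intro regular_intros less.hyps)
      show "2 * size (M - mset_set B) + card A' < 2 * size M + card A"
        using steps_measure[OF less.prems(1) that] .
      show "finite A'" using stepsD(2)[OF less.prems(1)] that by blast
      show "size (M - mset_set B) + card A' + 1 < 2 * k \<or> size (M - mset_set B) + 1 < k"
        using less.prems(2) stepsD(3,4)[OF less.prems(1), of B A' M] that by auto
    qed
    then have "regular z ((1 - fps_X ^ card A) * completion_gf A M)"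
      unfolding completion_gf_rec'[OF less.prems(1)] by (auto intro!: regular_sum)
    moreover have "z ^ card A \<noteq> 1"
      using 2 z less.prems(1) by (simp add: primitive_rootD(2) card_gt_0_iff)
    ultimately show ?thesis by (rule regular_cancel)
  next
    case 3
    then have size: "size M + 1 < k" using less.prems(2) by auto
    then have "A \<noteq> {}" using 3 by auto
    have "A \<subseteq> {Min A..Max A}" using less.prems(1) by auto
    then have "card A \<le> card {Min A..Max A}" by (intro card_mono) auto
    then have card_less: "card (set_mset M) < card {Min A..<Max A}"
      using size 3 size_mset_mono[OF mset_set_set_mset_msubset[of M]] by simp
    have "\<not> {Min A..<Max A} \<subseteq> set_mset M"
      using card_mono[OF finite_set_mset, of "{Min A..<Max A}" M] card_less by linarith
    then obtain j where j: "j \<in> {Min A..<Max A}" "j \<notin># M" by blast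
    have "Min A \<in> A" "Max A \<in> A" using \<open>A \<noteq> {}\<close> less.prems(1) by simp_all
    moreover have "Min A \<notin> {j<..}" "Max A \<notin> {..j}" using j(1) by simp_all
    ultimately have "A \<inter> {..j} \<subset> A" "A \<inter> {j<..} \<subset> A" by blast+
    then have card: "card (A \<inter> {..j}) < card A" "card (A \<inter> {j<..}) < card A"
      using less.prems(1) by (auto intro: psubset_card_mono)
    have sizes: "size (filter_mset Q M) \<le> size M" for Q by (rule size_filter_mset_lesseq)
    have "regular z (completion_gf (A \<inter> X) (filter_mset Q M))" if "card (A \<inter> X) < card A" for X Q
    proof (rule less.hyps)
      show "2 * size (filter_mset Q M) + card (A \<inter> X) < 2 * size M + card A"
        using that sizes[of Q] by linarith
      show "size (filter_mset Q M) + card (A \<inter> X) + 1 < 2 * k \<or> size (filter_mset Q M) + 1 < k"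
        using size sizes[of Q] by linarith
    qed (use less.prems(1) in simp)
    then show ?thesis
      unfolding completion_gf_split[OF less.prems(1) j(2)] using card by (intro regular_intros)
  qed
qed

lemma contiguous_bonds:
  assumes "finite B" "j \<ge> 1" "{..<j} \<inter> Suc ` B = {}" "B \<subseteq> {..<j} \<union> Suc ` B"
  shows "B = {j - 1..<j - 1 + card B}"
proof (cases "B = {}")
  case False
  have ge: "j - 1 \<le> b" if "b \<in> B" for b using assms(3) that by (force simp: not_less)
  have down: "b - n \<in> B" if "b \<in> B" "n \<le> b - (j - 1)" for b n
    using that(2)
  proof (induction n)
    case (Suc n)
    then have "b - n \<in> B" "b - n \<ge> j" using assms(2) by auto
    then have "b - n \<in> Suc ` B" using assms(4) by (meson UnE lessThan_iff not_less subsetD)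
    then show ?case by (metis diff_Suc_1 diff_Suc_eq_diff_pred diff_commute image_iff)
  qed (use that(1) in simp)
  define m where "m = Max B"
  have m: "m \<in> B" "\<And>b. b \<in> B \<Longrightarrow> b \<le> m" using assms(1) False by (simp_all add: m_def)
  have eq: "B = {j - 1..m}"
  proof
    show "B \<subseteq> {j - 1..m}" using ge m by auto
    show "{j - 1..m} \<subseteq> B"
    proof
      fix x assume "x \<in> {j - 1..m}"
      then show "x \<in> B" using down[OF m(1), of "m - x"] by (simp add: diff_le_mono2)
    qed
  qed
  then have "j - 1 + card B = Suc m" using ge[OF m(1)] by simp
  then show ?thesis using eq by (simp add: atLeastLessThanSuc_atLeastAtMost)
qed simp

text \<open>
  The pole comes from the animals with two bonds between any two consecutive ones of their \<open>k\<close> rows.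
  Once the first \<open>j\<close> rows have been entered by one bond each, these bonds remain.
\<close>

definition critical :: "nat \<Rightarrow> nat \<Rightarrow> nat multiset" where
  "critical k j = mset_set {..<k - 1} + mset_set {j - 1..<k - 1}"

lemma critical_step:
  assumes "1 \<le> j" "j < j'" "j' \<le> k"
  shows "critical k j = critical k j' + mset_set {j - 1..<j' - 1}"
proof -
  have "{j - 1..<k - 1} = {j - 1..<j' - 1} \<union> {j' - 1..<k - 1}" using assms by auto
  then have "mset_set {j - 1..<k - 1} = mset_set {j - 1..<j' - 1} + mset_set {j' - 1..<k - 1}"
    by (simp add: mset_set_Union)
  then show ?thesis by (simp add: critical_def)
qed

definition left_factor :: "nat \<Rightarrow> complex \<Rightarrow> nat \<Rightarrow> complex" where
  "left_factor k z j = (\<Prod>i=j..<k. 1 / (1 - z ^ i))"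

lemma left_factor_Suc: "j < k \<Longrightarrow> left_factor k z j = left_factor k z (Suc j) / (1 - z ^ j)"
  unfolding left_factor_def by (simp add: prod.atLeast_Suc_lessThan)

lemma left_factor_sum:
  assumes "primitive_root k z" "1 \<le> j" "j < k"
  shows "(\<Sum>i\<in>{j<..k}. z ^ i * left_factor k z i) = (1 - z ^ j) * left_factor k z j"
  using assms(2,3)
proof (induction "k - j" arbitrary: j)
  case (Suc n)
  have zj: "z ^ j \<noteq> 1" using assms(1) Suc.prems by (intro primitive_rootD(2)) auto
  have "{j<..k} = insert (Suc j) {Suc j<..k}" using Suc.prems by auto
  then have sum: "(\<Sum>i\<in>{j<..k}. z ^ i * left_factor k z i) =
      z ^ Suc j * left_factor k z (Suc j) + (\<Sum>i\<in>{Suc j<..k}. z ^ i * left_factor k z i)"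
    by simp
  have "(\<Sum>i\<in>{Suc j<..k}. z ^ i * left_factor k z i) = (1 - z ^ Suc j) * left_factor k z (Suc j)"
  proof (cases "Suc j = k")
    case True
    then show ?thesis using primitive_rootD(1)[OF assms(1)] by simp
  next
    case False
    then show ?thesis using Suc.hyps(1)[of "Suc j"] Suc.hyps(2) Suc.prems by simp
  qed
  moreover have "(1 - z ^ j) * left_factor k z j = left_factor k z (Suc j)"
    using zj left_factor_Suc[OF Suc.prems(2), of z] by simp
  ultimately show ?case unfolding sum by (simp add: algebra_simps)
qed simp

lemma has_value_critical:
  assumes z: "primitive_root k z"
    and \<sigma>: "has_value z ((1 - fps_X ^ k) * completion_gf {..<k} (mset_set {..<k - 1})) \<sigma>"
    and "1 \<le> j" "j \<le> k" "size M + j + 1 = 2 * k"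
  shows "has_value z ((1 - fps_X ^ k) * completion_gf {..<j} M) (if M = critical k j then \<sigma> * left_factor k z j else 0)"
  using assms(3-5)
proof (induction "k - j" arbitrary: j M rule: less_induct)
  case less
  note zk = primitive_rootD(1)[OF z]
  show ?case
  proof (cases "j = k")
    case True
    show ?thesis
    proof (cases "M = mset_set {..<k - 1}")
      case M: True
      then show ?thesis using True \<sigma> by (simp add: critical_def left_factor_def)
    next
      case False
      have "\<not> {..<k - 1} \<subseteq> set_mset M"
      proof
        assume "{..<k - 1} \<subseteq> set_mset M"
        then have "mset_set {..<k - 1} \<subseteq># M" by (simp add: mset_set_le_iff)
        then have "mset_set {..<k - 1} \<subset># M" using False by (simp add: subset_mset.less_le)
        then have "size (mset_set {..<k - 1}) < size M" by (rule mset_subset_size)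
        then show False using less.prems True by simp
      qed
      then obtain i where i: "i < k - 1" "i \<notin># M" by auto
      have sizes: "size (filter_mset Q M) \<le> k - 1" for Q
        using size_filter_mset_lesseq[of Q M] less.prems True by linarith
      have "{..<k} \<inter> {..i} = {..i}" "{..<k} \<inter> {i<..} = {i<..<k}" using i by auto
      then have "completion_gf {..<k} M = completion_gf {..i} (filter_mset (\<lambda>l. l \<le> i) M) * completion_gf {i<..<k} (filter_mset (\<lambda>l. i < l) M)"
        using completion_gf_split[of "{..<k}" i M] i by simp
      moreover have "regular z (completion_gf {..i} (filter_mset (\<lambda>l. l \<le> i) M))"
        using sizes[of "\<lambda>l. l \<le> i"] i by (intro regular_completion_gf[OF z]) auto
      moreover have "regular z (completion_gf {i<..<k} (filter_mset (\<lambda>l. i < l) M))"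
        using sizes[of "\<lambda>l. i < l"] i by (intro regular_completion_gf[OF z]) auto
      ultimately have "regular z (completion_gf {..<k} M)" by (simp add: regular_intros)
      then have "has_value z ((1 - fps_X ^ k) * completion_gf {..<k} M) 0" by (rule regular_residue[OF _ zk])
      then show ?thesis using True False by (simp add: critical_def)
    qed
  next
    case False
    then have jk: "j < k" using less.prems by simp
    let ?R = "steps {..<j} M - {({}, {..<j})}"
    let ?c = "\<lambda>i. ({j - 1..<i - 1}, {..<i})"
    define w where "w = (\<lambda>(B, A' :: nat set). if M = critical k j \<and> (B, A') \<in> ?c ` {j<..k}
      then \<sigma> * (z ^ card A' * left_factor k z (card A')) else 0)"
    have step_value: "has_value z ((1 - fps_X ^ k) * (fps_X ^ card A' * completion_gf A' (M - mset_set B))) (w (B, A'))"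
      if BA: "(B, A') \<in> ?R" for B A'
    proof -
      have st: "(B, A') \<in> steps {..<j} M" using BA by simp
      note D = stepsD[OF finite_lessThan st]
      show ?thesis
      proof (cases "size (M - mset_set B) + card A' + 1 < 2 * k \<or> size (M - mset_set B) + 1 < k")
        case True
        then have "regular z (completion_gf A' (M - mset_set B))" using D(2) by (intro regular_completion_gf[OF z])
        then have "regular z (fps_X ^ card A' * completion_gf A' (M - mset_set B))" by (intro regular_intros)
        then have "has_value z ((1 - fps_X ^ k) * (fps_X ^ card A' * completion_gf A' (M - mset_set B))) 0"
          by (rule regular_residue[OF _ zk])
        moreover have "(B, A') \<notin> ?c ` {j<..k}"
        proof
          assume "(B, A') \<in> ?c ` {j<..k}"
          then obtain i where i: "j < i" "i \<le> k" "B = {j - 1..<i - 1}" "A' = {..<i}" by auto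
          then show False using True D(3) less.prems by auto
        qed
        ultimately show ?thesis by (simp add: w_def)
      next
        case noreg: False
        then have cA: "card A' = j + card B" using D(3,4) less.prems by simp
        have sub: "A' \<subseteq> {..<j} \<union> Suc ` B" "B \<subseteq> {..<j} \<union> Suc ` B"
          using st by (auto simp: steps_def)
        have cU: "card ({..<j} \<union> Suc ` B) + card ({..<j} \<inter> Suc ` B) = j + card B"
          using card_Un_Int[of "{..<j}" "Suc ` B"] D(1) by (simp add: card_image)
        have "card A' \<le> card ({..<j} \<union> Suc ` B)" using sub D(1) by (intro card_mono) auto
        then have "card ({..<j} \<inter> Suc ` B) = 0" "card A' = card ({..<j} \<union> Suc ` B)"
          using cU cA by linarith+
        then have disj: "{..<j} \<inter> Suc ` B = {}" and A': "A' = {..<j} \<union> Suc ` B"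
          using D(1) sub card_subset_eq[of "{..<j} \<union> Suc ` B" A'] by auto
        define i where "i = j + card B"
        have B: "B = {j - 1..<i - 1}"
          using contiguous_bonds[OF D(1) less.prems(1) disj sub(2)] less.prems(1) by (simp add: i_def)
        have "Suc ` B = {j..<i}" unfolding B using less.prems(1) by (auto simp: image_Suc_atLeastLessThan)
        then have A'i: "A' = {..<i}" unfolding A' by (auto simp: i_def)
        have "B \<noteq> {}" using BA A' by auto
        then have ij: "j < i" using D(1) by (simp add: i_def card_gt_0_iff)
        have ik: "i \<le> k" using noreg D(3) cA less.prems by (auto simp: i_def)
        have sz: "size (M - mset_set B) + i + 1 = 2 * k" using D(3) less.prems by (simp add: i_def)
        have "mset_set B \<subseteq># M" using st D(1) by (simp add: mset_set_le_iff steps_def)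
        then have "M = (M - mset_set B) + mset_set B" by simp
        then have iff: "M - mset_set B = critical k i \<longleftrightarrow> M = critical k j"
          using critical_step[OF less.prems(1) ij ik] B by (metis add_right_cancel)
        have "has_value z ((1 - fps_X ^ k) * completion_gf {..<i} (M - mset_set B))
            (if M = critical k j then \<sigma> * left_factor k z i else 0)"
          using less.hyps[of i "M - mset_set B"] ij ik sz jk less.prems(1) unfolding iff by simp
        then have "has_value z (fps_X ^ i * ((1 - fps_X ^ k) * completion_gf {..<i} (M - mset_set B)))
            (z ^ i * (if M = critical k j then \<sigma> * left_factor k z i else 0))"
          by (intro has_value_intros)
        moreover have "w (B, A') = z ^ i * (if M = critical k j then \<sigma> * left_factor k z i else 0)"
          using ij ik by (simp add: w_def B A'i)
        ultimately show ?thesis by (simp add: A'i mult_ac)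
      qed
    qed
    have "has_value z (\<Sum>x\<in>?R. (1 - fps_X ^ k) * (\<lambda>(B, A'). fps_X ^ card A' * completion_gf A' (M - mset_set B)) x) (\<Sum>x\<in>?R. w x)"
      using step_value by (intro has_value_sum) auto
    moreover have "(\<Sum>x\<in>?R. (1 - fps_X ^ k) * (\<lambda>(B, A'). fps_X ^ card A' * completion_gf A' (M - mset_set B)) x) =
        (1 - fps_X ^ k) * ((1 - fps_X ^ card {..<j}) * completion_gf {..<j} M)"
      unfolding completion_gf_rec'[OF finite_lessThan] by (rule sum_distrib_left[symmetric])
    ultimately have "has_value z ((1 - fps_X ^ j) * ((1 - fps_X ^ k) * completion_gf {..<j} M)) (\<Sum>x\<in>?R. w x)"
      by (simp add: mult.left_commute)
    then have val: "has_value z ((1 - fps_X ^ k) * completion_gf {..<j} M) ((\<Sum>x\<in>?R. w x) / (1 - z ^ j))"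
      using jk less.prems(1) z by (intro has_value_cancel primitive_rootD(2)) auto
    show ?thesis
    proof (cases "M = critical k j")
      case M: True
      have inj: "inj_on ?c {j<..k}" by (auto simp: inj_on_def lessThan_eq_iff)
      have "?c ` {j<..k} \<subseteq> ?R"
      proof
        fix x assume "x \<in> ?c ` {j<..k}"
        then obtain i where i: "j < i" "i \<le> k" "x = ?c i" by auto
        have "{j - 1..<i - 1} \<subseteq> set_mset M"
          unfolding M critical_def using i by auto
        moreover have "Suc ` {j - 1..<i - 1} = {j..<i}"
          using less.prems(1) i by (simp add: image_Suc_atLeastLessThan)
        ultimately show "x \<in> ?R" using i by (auto simp: steps_def lessThan_eq_iff)
      qed
      then have "(\<Sum>x\<in>?R. w x) = (\<Sum>x\<in>?c ` {j<..k}. w x)"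
        by (intro sum.mono_neutral_right) (auto simp: w_def finite_steps)
      also have "\<dots> = (\<Sum>i\<in>{j<..k}. w (?c i))" using inj by (simp add: sum.reindex)
      also have "\<dots> = (\<Sum>i\<in>{j<..k}. \<sigma> * (z ^ i * left_factor k z i))"
        by (intro sum.cong) (auto simp: w_def M)
      also have "\<dots> = \<sigma> * ((1 - z ^ j) * left_factor k z j)"
        using left_factor_sum[OF z less.prems(1) jk] by (simp flip: sum_distrib_left)
      finally have "(\<Sum>x\<in>?R. w x) / (1 - z ^ j) = \<sigma> * left_factor k z j"
        using primitive_rootD(2)[OF z, of j] less.prems(1) jk by simp
      then show ?thesis using val M by simp
    next
      case False
      then have "(\<Sum>x\<in>?R. w x) = 0" by (intro sum.neutral) (auto simp: w_def)
      then show ?thesis using val False by simp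
    qed
  qed
qed

section \<open>Peeling off the bottom row\<close>

definition row_sets :: "nat set \<Rightarrow> nat \<Rightarrow> nat set set" where
  "row_sets D x = {K. finite K \<and> insert x K \<subseteq> D \<union> Suc ` K}"

definition row_gf :: "nat set \<Rightarrow> nat \<Rightarrow> rat fps" where
  "row_gf D x = wgf (row_sets D x) card"

lemma row_structure:
  assumes "finite K" "K \<subseteq> {0, e} \<union> Suc ` K"
  obtains a b where "a \<le> e" "K = {..<a} \<union> {e..<e + b}"
proof -
  define X where "X = K \<inter> {..<e}"
  define Y where "Y = {i. e + i \<in> K}"
  have pred: "x \<in> K" if "Suc x \<in> K" "Suc x \<noteq> e" for x using assms(2) that by auto
  have closed: "Z = {..<card Z}" if "finite Z" "\<And>x. Suc x \<in> Z \<Longrightarrow> x \<in> Z" for Z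
  proof -
    have "Z \<subseteq> {..<1} \<union> Suc ` Z"
    proof
      fix x assume "x \<in> Z"
      then show "x \<in> {..<1} \<union> Suc ` Z" using that(2) by (cases x) auto
    qed
    then have "Z = {1 - 1..<1 - 1 + card Z}" using that(1) by (intro contiguous_bonds) auto
    then show ?thesis by (simp add: atLeast0LessThan)
  qed
  have X: "X = {..<card X}"
    by (rule closed) (use assms(1) in \<open>auto simp: X_def intro: pred\<close>)
  have "finite Y"
    unfolding Y_def by (rule finite_vimageI[of K "\<lambda>i. e + i", unfolded vimage_def]) (use assms(1) in auto)
  then have Y: "Y = {..<card Y}"
    by (rule closed) (auto simp: Y_def intro!: pred)
  have "K \<inter> {e..} = (\<lambda>i. e + i) ` Y"
    by (auto simp: Y_def image_iff le_iff_add)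
  also have "\<dots> = {e..<e + card Y}" by (subst Y) (simp add: image_add_atLeastLessThan add.commute flip: atLeast0LessThan)
  finally have "K \<inter> {e..} = {e..<e + card Y}" .
  moreover have "K = X \<union> K \<inter> {e..}" by (auto simp: X_def)
  ultimately have "K = {..<card X} \<union> {e..<e + card Y}" using X by metis
  moreover have "card X \<le> e"
    using card_mono[of "{..<e}" X] by (simp add: X_def)
  ultimately show ?thesis using that by blast
qed

lemma segments_in_row_sets:
  assumes "a \<le> e"
  shows "{..<a} \<union> {e..<e + b} \<in> row_sets {0, e} x \<longleftrightarrow> (if x < e then x \<le> a else x - e \<le> b)"
proof -
  have Suc: "Suc ` ({..<a} \<union> {e..<e + b}) = {Suc 0..<Suc a} \<union> {Suc e..<Suc (e + b)}"
    by (simp only: image_Un image_Suc_lessThan image_Suc_atLeastLessThan) auto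
  have "{..<a} \<union> {e..<e + b} \<subseteq> {0, e} \<union> ({Suc 0..<Suc a} \<union> {Suc e..<Suc (e + b)})"
    using assms by auto
  then have "insert x ({..<a} \<union> {e..<e + b}) \<subseteq> {0, e} \<union> Suc ` ({..<a} \<union> {e..<e + b}) \<longleftrightarrow>
      x \<in> {0, e} \<union> ({Suc 0..<Suc a} \<union> {Suc e..<Suc (e + b)})"
    unfolding Suc by (simp only: insert_subset) blast
  then have "{..<a} \<union> {e..<e + b} \<in> row_sets {0, e} x \<longleftrightarrow>
      x \<in> {0, e} \<union> ({Suc 0..<Suc a} \<union> {Suc e..<Suc (e + b)})"
    by (simp add: row_sets_def)
  then show ?thesis using assms by auto
qed

lemma one_minus_X_wgf_atLeast: "(1 - fps_X) * wgf {b..} id = fps_X ^ b"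
proof (rule fps_ext)
  fix m
  have "{z\<in>{b..}. id z = m} = (if b \<le> m then {m} else {})" for m by auto
  then have nth: "fps_nth (wgf {b..} id) m = (if b \<le> m then 1 else 0)" for m
    by (simp add: wgf_nth)
  show "fps_nth ((1 - fps_X) * wgf {b..} id) m = fps_nth (fps_X ^ b) m"
    by (cases m) (auto simp: left_diff_distrib nth fps_X_power_nth)
qed

lemma one_minus_X_wgf_atLeastAtMost:
  assumes "a \<le> Suc e"
  shows "(1 - fps_X) * wgf {a..e} id = fps_X ^ a - fps_X ^ Suc e"
proof (rule fps_ext)
  fix m
  have "{z\<in>{a..e}. id z = m} = (if a \<le> m \<and> m \<le> e then {m} else {})" for m by auto
  then have nth: "fps_nth (wgf {a..e} id) m = (if a \<le> m \<and> m \<le> e then 1 else 0)" for m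
    by (simp add: wgf_nth)
  show "fps_nth ((1 - fps_X) * wgf {a..e} id) m = fps_nth (fps_X ^ a - fps_X ^ Suc e) m"
    using assms by (cases m) (auto simp: left_diff_distrib nth fps_X_power_nth simp del: power_Suc)
qed

lemma card_segments: "a \<le> e \<Longrightarrow> card ({..<a} \<union> {e..<e + b}) = a + b"
  by (subst card_Un_disjoint) auto

lemma row_gf_two_sources:
  "(1 - fps_X) ^ 2 * row_gf {0, e} x =
    (if x < e then fps_X ^ x - fps_X ^ Suc e else fps_X ^ (x - e) - fps_X ^ Suc x)"
proof -
  define a0 where "a0 = (if x < e then x else 0)"
  define b0 where "b0 = (if x < e then 0 else x - e)"
  let ?f = "\<lambda>(a, b). {..<a} \<union> {e..<e + b}"
  have "bij_betw ?f ({a0..e} \<times> {b0..}) (row_sets {0, e} x)"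
    unfolding bij_betw_def
  proof
    show "inj_on ?f ({a0..e} \<times> {b0..})"
    proof (rule inj_onI, clarify)
      fix a b a' b'
      assume *: "a \<in> {a0..e}" "a' \<in> {a0..e}" "{..<a} \<union> {e..<e + b} = {..<a'} \<union> {e..<e + b'}"
      have "({..<a} \<union> {e..<e + b}) \<inter> {..<e} = {..<a}" "({..<a'} \<union> {e..<e + b'}) \<inter> {..<e} = {..<a'}"
        using * by auto
      then have "a = a'" using *(3) by (metis lessThan_eq_iff)
      moreover have "a + b = a' + b'" using *(1,2) card_segments[of a e b] card_segments[of a' e b'] *(3) by simp
      ultimately show "a = a' \<and> b = b'" by simp
    qed
    show "?f ` ({a0..e} \<times> {b0..}) = row_sets {0, e} x"
    proof (intro equalityI subsetI)
      fix K assume "K \<in> ?f ` ({a0..e} \<times> {b0..})"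
      then show "K \<in> row_sets {0, e} x"
        by (auto simp: segments_in_row_sets a0_def b0_def)
    next
      fix K assume K: "K \<in> row_sets {0, e} x"
      then obtain a b where ab: "a \<le> e" "K = {..<a} \<union> {e..<e + b}"
        using row_structure[of K e] by (auto simp: row_sets_def)
      then have "(a, b) \<in> {a0..e} \<times> {b0..}"
        using K by (auto simp: segments_in_row_sets a0_def b0_def split: if_splits)
      then show "K \<in> ?f ` ({a0..e} \<times> {b0..})" using ab by force
    qed
  qed
  then have "row_gf {0, e} x = wgf ({a0..e} \<times> {b0..}) (\<lambda>z. id (fst z) + id (snd z))"
    unfolding row_gf_def by (rule wgf_bij[symmetric]) (auto simp: card_segments)
  also have "\<dots> = wgf {a0..e} id * wgf {b0..} id"
    by (rule wgf_Times) (auto simp: finite_fibres_def)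
  finally have "(1 - fps_X) ^ 2 * row_gf {0, e} x = ((1 - fps_X) * wgf {a0..e} id) * ((1 - fps_X) * wgf {b0..} id)"
    by (simp add: power2_eq_square mult_ac)
  also have "\<dots> = (fps_X ^ a0 - fps_X ^ Suc e) * fps_X ^ b0"
    by (subst one_minus_X_wgf_atLeastAtMost) (auto simp: a0_def one_minus_X_wgf_atLeast)
  also have "\<dots> = (if x < e then fps_X ^ x - fps_X ^ Suc e else fps_X ^ (x - e) - fps_X ^ Suc x)"
    by (auto simp: a0_def b0_def left_diff_distrib simp flip: power_add power_Suc)
  finally show ?thesis .
qed

lemma row_gf_one_source:
  "(1 - fps_X) * row_gf {e} x = (if e \<le> x then fps_X ^ (x - e) else 0)"
proof -
  have shape: "\<exists>b. K = {e..<e + b} \<and> e \<le> x \<and> x - e \<le> b" if K: "K \<in> row_sets {e} x" for K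
  proof -
    have K0: "K \<in> row_sets {0, e} x" using K by (auto simp: row_sets_def)
    then obtain a b where ab: "a \<le> e" "K = {..<a} \<union> {e..<e + b}"
      using row_structure[of K e] by (auto simp: row_sets_def)
    have "a = 0"
    proof (rule ccontr)
      assume "a \<noteq> 0"
      then have "0 \<in> K" using ab by auto
      then show False using K ab \<open>a \<noteq> 0\<close> by (auto simp: row_sets_def)
    qed
    then have Kb: "K = {e..<e + b}" using ab by simp
    have "e \<le> x" using K by (auto simp: row_sets_def Kb)
    moreover have "x - e \<le> b" using K0 \<open>e \<le> x\<close> segments_in_row_sets[OF ab(1), of b x] ab(2) by simp
    ultimately show ?thesis using Kb by blast
  qed
  show ?thesis
  proof (cases "e \<le> x")
    case True
    have "bij_betw (\<lambda>b. {e..<e + b}) {x - e..} (row_sets {e} x)"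
      unfolding bij_betw_def
    proof
      show "inj_on (\<lambda>b. {e..<e + b}) {x - e..}"
        by (rule inj_on_inverseI[of _ card]) simp
      show "(\<lambda>b. {e..<e + b}) ` {x - e..} = row_sets {e} x"
      proof (intro equalityI subsetI)
        fix K assume "K \<in> (\<lambda>b. {e..<e + b}) ` {x - e..}"
        then obtain b where b: "x - e \<le> b" "K = {e..<e + b}" by auto
        have "Suc ` K = {Suc e..<Suc (e + b)}" unfolding b by (rule image_Suc_atLeastLessThan)
        then show "K \<in> row_sets {e} x" using b True by (auto simp: row_sets_def)
      next
        fix K assume "K \<in> row_sets {e} x"
        then show "K \<in> (\<lambda>b. {e..<e + b}) ` {x - e..}" using shape by force
      qed
    qed
    then have "row_gf {e} x = wgf {x - e..} id"
      unfolding row_gf_def by (rule wgf_bij[symmetric]) simp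
    then show ?thesis using True by (simp add: one_minus_X_wgf_atLeast)
  next
    case False
    then have "row_sets {e} x = {}" using shape by auto
    then have "row_gf {e} x = 0" by (intro fps_ext) (simp add: row_gf_def wgf_nth)
    then show ?thesis using False by simp
  qed
qed

definition rjoin :: "nat set \<Rightarrow> cell set \<Rightarrow> cell set" where
  "rjoin K h = (join K (h\<inverse>))\<inverse>"

lemma in_rjoin [simp]:
  "(i, 0) \<in> rjoin K h \<longleftrightarrow> i \<in> K" "(i, Suc j) \<in> rjoin K h \<longleftrightarrow> (i, j) \<in> h"
  by (simp_all add: rjoin_def)

lemma rjoin_cases: obtains K h where "k = rjoin K h"
proof
  show "k = rjoin (head (k\<inverse>)) ((tail (k\<inverse>))\<inverse>)" by (simp add: rjoin_def)
qed

lemma rjoin_inject: "rjoin K h = rjoin K' h' \<longleftrightarrow> K = K' \<and> h = h'"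
  unfolding rjoin_def by (metis converse_converse head_join tail_join)

lemma finite_rjoin [simp]: "finite (rjoin K h) \<longleftrightarrow> finite K \<and> finite h"
  by (simp add: rjoin_def)

lemma card_rjoin: "finite K \<Longrightarrow> finite h \<Longrightarrow> card (rjoin K h) = card K + card h"
  by (simp add: rjoin_def)

lemma rows_rjoin:
  assumes "finite T" "finite s"
  shows "rows (rjoin T s) = replicate_mset (card T) 0 + image_mset Suc (rows s)"
proof -
  have "rjoin T s = (\<lambda>i. (i, 0)) ` T \<union> map_prod id Suc ` s"
  proof -
    have "(i, j) \<in> rjoin T s \<longleftrightarrow> (i, j) \<in> (\<lambda>i. (i, 0)) ` T \<union> map_prod id Suc ` s" for i j
      by (cases j) force+
    then show ?thesis by auto
  qed
  moreover have "mset_set ((\<lambda>i. (i, 0::nat)) ` T \<union> map_prod id Suc ` s) =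
      mset_set ((\<lambda>i. (i, 0)) ` T) + mset_set (map_prod id Suc ` s)"
    using assms by (intro mset_set_Union) auto
  moreover have "inj_on (map_prod id Suc) s" "inj_on (\<lambda>i. (i, 0::nat)) T" by (auto simp: inj_on_def)
  ultimately show ?thesis
    by (simp add: rows_def image_mset.compositionality comp_def image_mset_const_eq flip: image_mset_mset_set)
qed

lemma configs_rjoin:
  "(rjoin K h, rjoin T s) \<in> configs S \<longleftrightarrow>
     finite K \<and> finite T \<and> K \<union> T \<subseteq> head (S\<inverse>) \<union> Suc ` K \<and>
     (h, s) \<in> configs ((tail (S\<inverse>))\<inverse> \<union> T \<times> {0})"
proof -
  have eq: "(tail (S\<inverse>) \<union> {0} \<times> T)\<inverse> = (tail (S\<inverse>))\<inverse> \<union> T \<times> {0}" by auto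
  have "(rjoin K h, rjoin T s) \<in> configs S \<longleftrightarrow> (join T (s\<inverse>), join K (h\<inverse>)) \<in> configs (S\<inverse>)"
    using configs_converse[of "rjoin T s" "rjoin K h" S] by (simp add: rjoin_def)
  also have "\<dots> \<longleftrightarrow> finite T \<and> finite K \<and> T \<union> K \<subseteq> head (S\<inverse>) \<union> Suc ` K \<and>
      (s\<inverse>, h\<inverse>) \<in> configs (tail (S\<inverse>) \<union> {0} \<times> T)"
    by (rule configs_join)
  also have "(s\<inverse>, h\<inverse>) \<in> configs (tail (S\<inverse>) \<union> {0} \<times> T) \<longleftrightarrow>
      (h, s) \<in> configs ((tail (S\<inverse>))\<inverse> \<union> T \<times> {0})"
    by (metis configs_converse converse_converse eq)
  finally show ?thesis by (auto simp: Un_commute)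
qed

text \<open>
  One vertical bond between any two consecutive rows, where row \<open>0\<close> is entered in column \<open>e\<close> by the
  bond from a row that has already been peeled off.
\<close>

definition tower :: "nat set \<Rightarrow> nat \<Rightarrow> nat \<Rightarrow> rat fps" where
  "tower A n e = wgf (row_configs (insert (e, 0) ({0} \<times> A)) (mset_set {..<n})) hcard"

definition sources :: "nat set \<Rightarrow> nat \<Rightarrow> nat set" where
  "sources A e = insert e (if 0 \<in> A then {0} else {})"

lemma rows_Suc_iff:
  assumes "finite T" "finite s"
  shows "rows (rjoin T s) = mset_set {..<Suc n} \<longleftrightarrow> card T = 1 \<and> rows s = mset_set {..<n}"
proof -
  have eq: "mset_set {..<Suc n} = replicate_mset 1 0 + image_mset Suc (mset_set {..<n})"
    by (simp add: lessThan_Suc_eq_insert_0 image_mset_mset_set)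
  have "count (image_mset Suc M) 0 = 0" for M by (simp add: count_eq_zero_iff)
  then have "card T = 1" if "rows (rjoin T s) = mset_set {..<Suc n}"
    using arg_cong[OF that, of "\<lambda>M. count M 0"] assms unfolding eq rows_rjoin[OF assms] by simp
  then show ?thesis unfolding eq rows_rjoin[OF assms]
    by (auto dest: multiset.inj_map_strong[rotated])
qed

lemma row_sets_bound:
  assumes "K \<in> row_sets D x" "\<And>d. d \<in> D \<Longrightarrow> d \<le> e"
  shows "x \<le> e + card K"
proof -
  have fin: "finite K" using assms by (simp add: row_sets_def)
  have "y \<le> e + card {i\<in>K. i < y}" if "y \<in> D \<union> Suc ` K" for y
    using that
  proof (induction y)
    case (Suc y)
    show ?case
    proof (cases "Suc y \<in> D")
      case False
      then have "y \<in> K" using Suc.prems by auto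
      then have "y \<in> D \<union> Suc ` K" using assms(1) by (auto simp: row_sets_def)
      then have "y \<le> e + card {i\<in>K. i < y}" by (rule Suc.IH)
      moreover have "card {i\<in>K. i < y} < card {i\<in>K. i < Suc y}"
        using fin \<open>y \<in> K\<close> by (intro psubset_card_mono) auto
      ultimately show ?thesis by simp
    qed (use assms(2) in \<open>simp add: trans_le_add1\<close>)
  qed simp
  moreover have "x \<in> D \<union> Suc ` K" using assms(1) by (simp add: row_sets_def)
  ultimately have "x \<le> e + card {i\<in>K. i < x}" by blast
  also have "card {i\<in>K. i < x} \<le> card K" using fin by (intro card_mono) auto
  finally show ?thesis by simp
qed

lemma finite_fibres_row_sets:
  assumes "finite D"
  shows "finite_fibres (row_sets D x) card"
proof -
  obtain e where e: "\<And>d. d \<in> D \<Longrightarrow> d \<le> e"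
    using assms finite_nat_set_iff_bounded_le by auto
  have "finite {K\<in>row_sets D x. card K = m}" for m
  proof (rule finite_subset)
    show "{K\<in>row_sets D x. card K = m} \<subseteq> Pow {..e + m}"
    proof
      fix K assume K: "K \<in> {K\<in>row_sets D x. card K = m}"
      have "y \<le> e + m" if "y \<in> K" for y
      proof -
        have "K \<in> row_sets D y" using K that by (auto simp: row_sets_def)
        then show ?thesis using row_sets_bound[of K D y e] e K by simp
      qed
      then show "K \<in> Pow {..e + m}" by auto
    qed
  qed simp
  then show ?thesis by (simp add: finite_fibres_def)
qed

lemma tower_Suc_nth:
  assumes "finite A"
  shows "fps_nth (tower A (Suc n) e) m =
    (\<Sum>x\<le>e + m. fps_nth (row_gf (sources A e) x * tower {j. Suc j \<in> A} n x) m)"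
proof -
  let ?S = "insert (e, 0) ({0} \<times> A)" and ?D = "sources A e" and ?A = "{j. Suc j \<in> A}"
  define R where "R = (\<lambda>x. row_configs (insert (x, 0) ({0} \<times> ?A)) (mset_set {..<n}))"
  define T where "T = (\<lambda>x. row_sets ?D x \<times> R x)"
  define w where "w = (\<lambda>(x :: nat) (z :: nat set \<times> cell set \<times> cell set). card (fst z) + hcard (snd z))"
  define f where "f = (\<lambda>(x, K, h, s). (rjoin K h, rjoin {x :: nat} s))"
  have finA: "finite ?A"
    using finite_vimageI[OF assms, of Suc] by (simp add: vimage_def)
  have head: "head (?S\<inverse>) = ?D" by (auto simp: sources_def)
  have tail: "(tail (?S\<inverse>))\<inverse> = {0} \<times> ?A" by auto
  have iff: "(rjoin K h, rjoin {x} s) \<in> row_configs ?S (mset_set {..<Suc n}) \<longleftrightarrow>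
      K \<in> row_sets ?D x \<and> (h, s) \<in> R x" for K h x s
  proof (cases "finite s")
    case True
    then show ?thesis
      unfolding row_configs_def R_def row_sets_def
      using rows_Suc_iff[of "{x}" s n] by (auto simp: configs_rjoin head tail)
  next
    case False
    then show ?thesis by (auto simp: row_configs_def configs_def R_def)
  qed
  have bij: "bij_betw f (Sigma {..e + m} (\<lambda>x. {z\<in>T x. w x z = m}))
      {z\<in>row_configs ?S (mset_set {..<Suc n}). hcard z = m}"
    unfolding bij_betw_def
  proof
    show "inj_on f (Sigma {..e + m} (\<lambda>x. {z\<in>T x. w x z = m}))"
      by (auto simp: inj_on_def f_def rjoin_inject)
    have wt: "hcard (rjoin K h, rjoin {x} s) = w x (K, h, s)" if "K \<in> row_sets ?D x" "(h, s) \<in> R x" for x K h s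
      using that by (simp add: w_def row_sets_def R_def row_configs_def configs_def card_rjoin)
    show "f ` (Sigma {..e + m} (\<lambda>x. {z\<in>T x. w x z = m})) = {z\<in>row_configs ?S (mset_set {..<Suc n}). hcard z = m}"
    proof (intro equalityI subsetI)
      fix y assume "y \<in> f ` (Sigma {..e + m} (\<lambda>x. {z\<in>T x. w x z = m}))"
      then obtain x K h s where "K \<in> row_sets ?D x" "(h, s) \<in> R x" "w x (K, h, s) = m" "y = (rjoin K h, rjoin {x} s)"
        by (auto simp: f_def T_def)
      then show "y \<in> {z\<in>row_configs ?S (mset_set {..<Suc n}). hcard z = m}"
        using iff[of K h x s] wt[of K x h s] by simp
    next
      fix y assume y: "y \<in> {z\<in>row_configs ?S (mset_set {..<Suc n}). hcard z = m}"
      obtain K h T' s where y_eq: "y = (rjoin K h, rjoin T' s)"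
        by (metis rjoin_cases surj_pair)
      have fin: "finite T'" "finite s" and rw: "rows (rjoin T' s) = mset_set {..<Suc n}"
        using y unfolding y_eq row_configs_def configs_def by auto
      then have "card T' = 1" by (simp only: rows_Suc_iff[OF fin])
      then obtain x where x: "T' = {x}" by (auto simp: card_1_singleton_iff)
      have K: "K \<in> row_sets ?D x" "(h, s) \<in> R x" using iff[of K h x s] y by (auto simp: y_eq x)
      have wm: "w x (K, h, s) = m" using wt[OF K] y by (simp add: y_eq x)
      have "x \<le> e + card K" using K(1) by (rule row_sets_bound) (auto simp: sources_def split: if_splits)
      then have "x \<le> e + m" using wm by (simp add: w_def)
      then show "y \<in> f ` (Sigma {..e + m} (\<lambda>x. {z\<in>T x. w x z = m}))"
        using K wm by (force simp: f_def T_def y_eq x)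
    qed
  qed
  have ff: "finite_fibres (row_sets ?D x) card" "finite_fibres (R x) hcard" for x
    unfolding R_def using finA by (auto intro!: finite_fibres_row_sets finite_fibres_configs simp: sources_def)
  have prod: "wgf (T x) (w x) = row_gf ?D x * tower ?A n x" for x
    unfolding T_def w_def using wgf_Times[OF ff] by (simp add: row_gf_def tower_def R_def)
  have "finite {z\<in>T x. w x z = m}" for x
  proof (rule finite_subset)
    show "finite ((\<Union>i\<le>m. {a\<in>row_sets ?D x. card a = i}) \<times> (\<Union>i\<le>m. {b\<in>R x. hcard b = i}))"
      using ff[of x] by (auto simp: finite_fibres_def)
  qed (auto simp: T_def w_def)
  then have "card {z\<in>row_configs ?S (mset_set {..<Suc n}). hcard z = m} = (\<Sum>x\<le>e + m. card {z\<in>T x. w x z = m})"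
    using bij_betw_same_card[OF bij] by simp
  then show ?thesis
    by (simp add: tower_def[of A] wgf_nth flip: prod)
qed

section \<open>The simple pole coming from the right of a cut\<close>

text \<open>Truncating at \<open>m\<close> is harmless when \<open>fps_X ^ e\<close> divides \<open>g e\<close>.\<close>

definition fps_series :: "(nat \<Rightarrow> rat fps) \<Rightarrow> rat fps" where
  "fps_series g = Abs_fps (\<lambda>m. \<Sum>e\<le>m. fps_nth (g e) m)"

definition ascending :: "(nat \<Rightarrow> rat fps) \<Rightarrow> bool" where
  "ascending g \<longleftrightarrow> (\<forall>e m. m < e \<longrightarrow> fps_nth (g e) m = 0)"

lemma fps_series_nth:
  assumes "ascending g" "m \<le> N"
  shows "fps_nth (fps_series g) m = (\<Sum>e\<le>N. fps_nth (g e) m)"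
proof -
  have "(\<Sum>e\<le>N. fps_nth (g e) m) = (\<Sum>e\<le>m. fps_nth (g e) m)"
    by (rule sum.mono_neutral_right) (use assms in \<open>auto simp: ascending_def\<close>)
  then show ?thesis by (simp add: fps_series_def)
qed

lemma fps_series_diff: "fps_series (\<lambda>e. f e - g e) = fps_series f - fps_series g"
  by (rule fps_ext) (simp add: fps_series_def sum_subtractf)

lemma fps_series_swap:
  "fps_series (\<lambda>e. fps_series (\<lambda>x. g e x)) = fps_series (\<lambda>x. fps_series (\<lambda>e. g e x))"
  by (rule fps_ext) (simp add: fps_series_def, rule sum.swap)

lemma fps_series_cmult:
  assumes "ascending g"
  shows "fps_series (\<lambda>e. c * g e) = c * fps_series g"
proof (rule fps_ext)
  fix m
  have "fps_nth (c * fps_series g) m = (\<Sum>i=0..m. fps_nth c i * fps_nth (fps_series g) (m - i))"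
    by (simp add: fps_mult_nth)
  also have "\<dots> = (\<Sum>i=0..m. fps_nth c i * (\<Sum>e\<le>m. fps_nth (g e) (m - i)))"
    by (intro sum.cong refl) (simp add: fps_series_nth[OF assms, of _ m])
  also have "\<dots> = (\<Sum>e\<le>m. \<Sum>i=0..m. fps_nth c i * fps_nth (g e) (m - i))"
    by (simp add: sum_distrib_left sum.swap[of _ "{0..m}"])
  also have "\<dots> = fps_nth (fps_series (\<lambda>e. c * g e)) m"
    by (simp add: fps_series_def fps_mult_nth)
  finally show "fps_nth (fps_series (\<lambda>e. c * g e)) m = fps_nth (c * fps_series g) m" ..
qed

lemma fps_series_mult_right:
  "ascending g \<Longrightarrow> fps_series (\<lambda>e. g e * c) = fps_series g * c"
  using fps_series_cmult[of g c] by (simp add: mult.commute)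

lemma ascendingI: "(\<And>e. \<exists>h. g e = fps_X ^ e * h) \<Longrightarrow> ascending g"
  unfolding ascending_def by (metis fps_X_power_mult_nth)

lemma ascending_X_power: "a \<ge> 1 \<Longrightarrow> ascending (\<lambda>e. fps_X ^ (a * e) * f e)"
proof (rule ascendingI)
  fix e assume "a \<ge> 1"
  then have "a * e = e + (a - 1) * e" by (cases a) auto
  then show "\<exists>h. fps_X ^ (a * e) * f e = fps_X ^ e * h"
    by (metis mult.assoc power_add)
qed

lemma ascending_if:
  "ascending f \<Longrightarrow> ascending g \<Longrightarrow> ascending (\<lambda>e. if Q e then f e else g e)"
  by (auto simp: ascending_def)

lemma ascending_cmult:
  assumes "ascending f"
  shows "ascending (\<lambda>e. c * f e)"
  using assms by (auto simp: ascending_def fps_mult_nth intro!: sum.neutral)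

lemma ascending_mult_right: "ascending f \<Longrightarrow> ascending (\<lambda>e. f e * g e)"
  by (auto simp: ascending_def fps_mult_nth intro!: sum.neutral)

lemma fps_series_atMost:
  assumes "ascending g"
  shows "fps_series (\<lambda>e. if e \<le> n then g e else 0) = (\<Sum>e\<le>n. g e)"
proof (rule fps_ext)
  fix m
  have "ascending (\<lambda>e. if e \<le> n then g e else 0)" using assms by (auto simp: ascending_def)
  then have "fps_nth (fps_series (\<lambda>e. if e \<le> n then g e else 0)) m = (\<Sum>e\<le>n + m. fps_nth (if e \<le> n then g e else 0) m)"
    by (rule fps_series_nth) simp
  also have "\<dots> = (\<Sum>e\<le>n. fps_nth (g e) m)"
    by (rule sum.mono_neutral_cong_right) auto
  finally show "fps_nth (fps_series (\<lambda>e. if e \<le> n then g e else 0)) m = fps_nth (\<Sum>e\<le>n. g e) m"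
    by (simp add: fps_sum_nth)
qed

lemma geometric_atMost:
  "(1 - fps_X ^ a) * (\<Sum>e\<le>n. fps_X ^ (a * e)) = (1 - fps_X ^ (a * Suc n) :: rat fps)"
  using sum_gp_basic[of "fps_X ^ a :: rat fps" n] unfolding power_mult .

lemma geometric_series:
  assumes "a \<ge> 1"
  shows "(1 - fps_X ^ a) * fps_series (\<lambda>e. fps_X ^ (a * e)) = 1"
proof (rule fps_ext)
  fix m
  have "ascending (\<lambda>e. fps_X ^ (a * e))" using ascending_X_power[OF assms, of "\<lambda>_. 1"] by simp
  then have "(1 - fps_X ^ a) * fps_series (\<lambda>e. fps_X ^ (a * e)) = fps_series (\<lambda>e. (1 - fps_X ^ a) * fps_X ^ (a * e))"
    by (rule fps_series_cmult[symmetric])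
  then have "fps_nth ((1 - fps_X ^ a) * fps_series (\<lambda>e. fps_X ^ (a * e))) m =
      fps_nth ((1 - fps_X ^ a) * (\<Sum>e\<le>m. fps_X ^ (a * e))) m"
    by (simp add: fps_series_def sum_distrib_left fps_sum_nth)
  also have "\<dots> = fps_nth (1 - fps_X ^ (a * Suc m)) m" by (simp only: geometric_atMost)
  also have "\<dots> = fps_nth 1 m"
  proof -
    have "m < a * Suc m" using assms by (cases a) auto
    then show ?thesis by (simp add: fps_X_power_nth del: mult_Suc_right)
  qed
  finally show "fps_nth ((1 - fps_X ^ a) * fps_series (\<lambda>e. fps_X ^ (a * e))) m = fps_nth 1 m" .
qed

definition moment :: "nat \<Rightarrow> (nat \<Rightarrow> rat fps) \<Rightarrow> rat fps" where
  "moment a f = fps_series (\<lambda>e. fps_X ^ (a * e) * f e)"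

lemma ascending_kernel:
  assumes "\<And>d. d \<in> D \<Longrightarrow> d \<le> e"
  shows "ascending (\<lambda>x. fps_X ^ e * row_gf D x)"
  unfolding ascending_def
proof (intro allI impI)
  fix x m :: nat assume "m < x"
  show "fps_nth (fps_X ^ e * row_gf D x) m = 0"
  proof (cases "m < e")
    case False
    then have "{K\<in>row_sets D x. card K = m - e} = {}"
      using row_sets_bound[of _ D x e] assms \<open>m < x\<close> by fastforce
    then have "card {K\<in>row_sets D x. card K = m - e} = 0" by (simp only: card.empty)
    then show ?thesis by (simp add: fps_X_power_mult_nth row_gf_def wgf_nth)
  qed (simp add: fps_X_power_mult_nth)
qed

lemma sources_le: "d \<in> sources A e \<Longrightarrow> d \<le> e"
  by (auto simp: sources_def split: if_splits)

lemma tower_Suc: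
  assumes "finite A"
  shows "fps_X ^ e * tower A (Suc n) e =
    fps_series (\<lambda>x. fps_X ^ e * row_gf (sources A e) x * tower {j. Suc j \<in> A} n x)"
proof (rule fps_ext)
  fix m
  show "fps_nth (fps_X ^ e * tower A (Suc n) e) m =
    fps_nth (fps_series (\<lambda>x. fps_X ^ e * row_gf (sources A e) x * tower {j. Suc j \<in> A} n x)) m"
    by (simp add: fps_series_def fps_X_power_mult_nth mult.assoc tower_Suc_nth[OF assms])
qed

lemma moment_tower_Suc:
  assumes "finite A" "a \<ge> 1"
  shows "c * moment a (tower A (Suc n)) =
    fps_series (\<lambda>x. fps_series (\<lambda>e. fps_X ^ (a * e) * (c * row_gf (sources A e) x)) * tower {j. Suc j \<in> A} n x)"
proof -
  let ?t = "tower {j. Suc j \<in> A} n"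
  have "c * (fps_X ^ (a * e) * tower A (Suc n) e) =
      fps_series (\<lambda>x. fps_X ^ (a * e) * (c * row_gf (sources A e) x) * ?t x)" for e
  proof -
    have a: "a * e = (a - 1) * e + e" using assms(2) by (cases a) auto
    have "c * (fps_X ^ (a * e) * tower A (Suc n) e) = c * fps_X ^ ((a - 1) * e) * (fps_X ^ e * tower A (Suc n) e)"
      unfolding a by (simp add: power_add mult_ac)
    also have "\<dots> = fps_series (\<lambda>x. c * fps_X ^ ((a - 1) * e) * (fps_X ^ e * row_gf (sources A e) x * ?t x))"
      unfolding tower_Suc[OF assms(1)]
      by (intro fps_series_cmult[symmetric] ascending_mult_right ascending_kernel sources_le)
    finally show ?thesis unfolding a by (simp add: power_add mult_ac)
  qed
  then have "c * moment a (tower A (Suc n)) =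
      fps_series (\<lambda>e. fps_series (\<lambda>x. fps_X ^ (a * e) * (c * row_gf (sources A e) x) * ?t x))"
    unfolding moment_def by (simp add: ascending_X_power[OF assms(2)] flip: fps_series_cmult)
  also have "\<dots> = fps_series (\<lambda>x. fps_series (\<lambda>e. fps_X ^ (a * e) * (c * row_gf (sources A e) x) * ?t x))"
    by (rule fps_series_swap)
  also have "\<dots> = fps_series (\<lambda>x. fps_series (\<lambda>e. fps_X ^ (a * e) * (c * row_gf (sources A e) x)) * ?t x)"
    by (simp add: fps_series_mult_right ascending_X_power[OF assms(2)])
  finally show ?thesis .
qed

lemma pred_atMost: "{j. Suc j \<in> {..Suc n}} = {..n}" "{j. Suc j \<in> {1..Suc n}} = {..n}"
  by auto

text \<open>
  Subtracting the configurations in which row \<open>0\<close> does not start in column \<open>0\<close> removes the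
  terms that would resonate for \<open>a = 1\<close>; those are regular by \<open>regular_completion_gf\<close>.
\<close>

lemma moment_full_minus_open:
  assumes "a \<ge> 1"
  shows "(1 - fps_X ^ a) * (1 - fps_X ^ Suc a) *
    ((1 - fps_X) ^ 2 * moment a (tower {..Suc n} (Suc n)) - (1 - fps_X) * moment a (tower {1..Suc n} (Suc n))) =
    fps_X ^ a * (1 + fps_X - fps_X ^ 2 - fps_X ^ Suc a) * moment (Suc a) (tower {..n} n) -
    fps_X * (1 - fps_X ^ Suc a) * moment 1 (tower {..n} n)"
proof -
  let ?X = "fps_X :: rat fps"
  let ?t = "tower {..n} n"
  define top where "top = (\<lambda>e x. if e \<le> x then - (?X ^ Suc x) else ?X ^ x - ?X ^ Suc e)"
  define ker where "ker = (\<lambda>x. fps_series (\<lambda>e. ?X ^ (a * e) * top e x))"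
  have top: "(1 - ?X) ^ 2 * row_gf (sources {..Suc n} e) x - (1 - ?X) * row_gf (sources {1..Suc n} e) x = top e x" for e x
    unfolding sources_def
    by (simp add: insert_commute[of e 0] row_gf_two_sources row_gf_one_source top_def del: power_Suc)
  have asc: "ascending (\<lambda>e. ?X ^ (a * e))" "ascending (\<lambda>e. ?X ^ (Suc a * e))"
    using ascending_X_power[of a "\<lambda>_. 1"] ascending_X_power[of "Suc a" "\<lambda>_. 1"] assms by simp_all
  have "(1 - ?X) ^ 2 * moment a (tower {..Suc n} (Suc n)) - (1 - ?X) * moment a (tower {1..Suc n} (Suc n)) =
      fps_series (\<lambda>x. ker x * ?t x)"
    unfolding moment_tower_Suc[OF finite_atMost assms] moment_tower_Suc[OF finite_atLeastAtMost assms]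
      pred_atMost ker_def top[symmetric] right_diff_distrib fps_series_diff left_diff_distrib ..
  also have "(1 - ?X ^ a) * (1 - ?X ^ Suc a) * \<dots> = fps_series (\<lambda>x. (1 - ?X ^ a) * (1 - ?X ^ Suc a) * ker x * ?t x)"
  proof -
    have "ascending ker"
      unfolding ker_def top_def ascending_def
    proof (intro allI impI)
      fix x m :: nat assume "m < x"
      have "fps_nth (?X ^ (a * e) * (if e \<le> x then - (?X ^ Suc x) else ?X ^ x - ?X ^ Suc e)) m = 0" if "e \<le> m" for e
        using that \<open>m < x\<close> by (auto simp: fps_X_power_mult_nth fps_X_power_nth simp del: power_Suc)
      then show "fps_nth (fps_series (\<lambda>e. ?X ^ (a * e) * (if e \<le> x then - (?X ^ Suc x) else ?X ^ x - ?X ^ Suc e))) m = 0"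
        by (simp add: fps_series_def)
    qed
    from fps_series_cmult[OF ascending_mult_right[OF this, of ?t], of "(1 - ?X ^ a) * (1 - ?X ^ Suc a)"]
    show ?thesis by (simp only: mult.assoc)
  qed
  also have "(\<lambda>x. (1 - ?X ^ a) * (1 - ?X ^ Suc a) * ker x * ?t x) =
    (\<lambda>x. ?X ^ a * (1 + ?X - ?X ^ 2 - ?X ^ Suc a) * (?X ^ (Suc a * x) * ?t x) - ?X * (1 - ?X ^ Suc a) * (?X ^ (1 * x) * ?t x))"
  proof
    fix x
    define G where "G = (\<lambda>a. fps_series (\<lambda>e. ?X ^ (a * e)))"
    define S where "S = (\<lambda>a. \<Sum>e\<le>x. ?X ^ (a * e))"
    have S: "fps_series (\<lambda>e. if e \<le> x then ?X ^ (b * e) else 0) = S b" if "b \<in> {a, Suc a}" for b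
      unfolding S_def using asc that by (intro fps_series_atMost) auto
    have "(\<lambda>e. ?X ^ (a * e) * top e x) =
      (\<lambda>e. ?X ^ x * ?X ^ (a * e) - ?X * ?X ^ (Suc a * e) -
        (?X ^ x * (1 + ?X) * (if e \<le> x then ?X ^ (a * e) else 0) - ?X * (if e \<le> x then ?X ^ (Suc a * e) else 0)))"
      by (rule ext) (simp add: top_def algebra_simps power_add)
    then have ker: "ker x = ?X ^ x * G a - ?X * G (Suc a) - (?X ^ x * (1 + ?X) * S a - ?X * S (Suc a))"
      unfolding ker_def using asc
      by (simp only: fps_series_diff fps_series_cmult ascending_if ascending_def[of "\<lambda>_. 0"] S G_def insert_iff simp_thms)
        (simp add: fps_series_cmult ascending_if ascending_def[of "\<lambda>_. 0"] S)
    have G1: "(1 - ?X ^ a) * G a = 1" "(1 - ?X ^ Suc a) * G (Suc a) = 1"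
      unfolding G_def using assms by (simp_all only: geometric_series le_SucI)
    have S1: "(1 - ?X ^ a) * S a = 1 - ?X ^ a * ?X ^ (a * x)"
      "(1 - ?X ^ Suc a) * S (Suc a) = 1 - ?X ^ Suc a * (?X ^ x * ?X ^ (a * x))"
      unfolding S_def using geometric_atMost[of a x] geometric_atMost[of "Suc a" x]
      by (simp_all add: power_add algebra_simps)
    have "(1 - ?X ^ a) * (1 - ?X ^ Suc a) * ker x =
      ?X ^ x * (1 - ?X ^ Suc a) * ((1 - ?X ^ a) * G a) - ?X * (1 - ?X ^ a) * ((1 - ?X ^ Suc a) * G (Suc a)) -
      (?X ^ x * (1 + ?X) * (1 - ?X ^ Suc a) * ((1 - ?X ^ a) * S a) - ?X * (1 - ?X ^ a) * ((1 - ?X ^ Suc a) * S (Suc a)))"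
      unfolding ker by (simp only: algebra_simps)
    also have "\<dots> = ?X ^ a * (1 + ?X - ?X ^ 2 - ?X ^ Suc a) * (?X ^ x * ?X ^ (a * x)) - ?X * (1 - ?X ^ Suc a) * ?X ^ x"
      unfolding G1 S1 by (simp add: algebra_simps power2_eq_square)
    finally have "(1 - ?X ^ a) * (1 - ?X ^ Suc a) * ker x =
      ?X ^ a * (1 + ?X - ?X ^ 2 - ?X ^ Suc a) * ?X ^ (Suc a * x) - ?X * (1 - ?X ^ Suc a) * ?X ^ (1 * x)"
      by (simp add: power_add)
    then show "(1 - ?X ^ a) * (1 - ?X ^ Suc a) * ker x * ?t x =
      ?X ^ a * (1 + ?X - ?X ^ 2 - ?X ^ Suc a) * (?X ^ (Suc a * x) * ?t x) - ?X * (1 - ?X ^ Suc a) * (?X ^ (1 * x) * ?t x)"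
      by (simp only: left_diff_distrib mult.assoc)
  qed
  finally show ?thesis
    unfolding fps_series_diff moment_def
    by (simp only: fps_series_cmult ascending_X_power le_SucI[OF assms] order_refl)
qed

lemma moment_open:
  assumes "a \<ge> 2"
  shows "(1 - fps_X ^ (a - 1)) * ((1 - fps_X) * moment a (tower {1..Suc n} (Suc n))) =
    moment 1 (tower {..n} n) - fps_X ^ (a - 1) * moment a (tower {..n} n)"
proof -
  let ?X = "fps_X :: rat fps"
  let ?t = "tower {..n} n"
  have a: "a \<ge> 1" "a - 1 \<ge> 1" using assms by auto
  define ker where "ker = (\<lambda>x. \<Sum>e\<le>x. ?X ^ x * ?X ^ ((a - 1) * e))"
  have "fps_series (\<lambda>e. ?X ^ (a * e) * ((1 - ?X) * row_gf (sources {1..Suc n} e) x)) = ker x" for x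
  proof -
    have "?X ^ (a * e) * ((1 - ?X) * row_gf (sources {1..Suc n} e) x) =
        (if e \<le> x then ?X ^ x * ?X ^ ((a - 1) * e) else 0)" for e
    proof -
      have "a * e + (x - e) = x + (a - 1) * e" if "e \<le> x"
        using that assms by (cases a) auto
      then show ?thesis unfolding sources_def by (auto simp: row_gf_one_source simp flip: power_add)
    qed
    moreover have "ascending (\<lambda>e. ?X ^ x * ?X ^ ((a - 1) * e))"
      using ascending_cmult[OF ascending_X_power[OF a(2), of "\<lambda>_. 1"]] by simp
    ultimately show ?thesis by (simp only: fps_series_atMost ker_def)
  qed
  then have "(1 - ?X) * moment a (tower {1..Suc n} (Suc n)) = fps_series (\<lambda>x. ker x * ?t x)"
    unfolding moment_tower_Suc[OF finite_atLeastAtMost a(1)] pred_atMost by simp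
  also have "(1 - ?X ^ (a - 1)) * \<dots> = fps_series (\<lambda>x. (1 - ?X ^ (a - 1)) * (ker x * ?t x))"
  proof -
    have "ker = (\<lambda>x. ?X ^ (1 * x) * (\<Sum>e\<le>x. ?X ^ ((a - 1) * e)))"
      by (simp add: ker_def sum_distrib_left)
    then have "ascending ker" by (simp only: ascending_X_power order_refl)
    then show ?thesis by (simp only: fps_series_cmult ascending_mult_right)
  qed
  also have "(\<lambda>x. (1 - ?X ^ (a - 1)) * (ker x * ?t x)) =
      (\<lambda>x. ?X ^ (1 * x) * ?t x - ?X ^ (a - 1) * (?X ^ (a * x) * ?t x))"
  proof
    fix x
    have "(1 - ?X ^ (a - 1)) * ker x = ?X ^ x * ((1 - ?X ^ (a - 1)) * (\<Sum>e\<le>x. ?X ^ ((a - 1) * e)))"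
      by (simp only: ker_def mult.left_commute flip: sum_distrib_left)
    also have "\<dots> = ?X ^ x - ?X ^ (x + (a - 1) * Suc x)"
      by (simp only: geometric_atMost right_diff_distrib power_add mult_1_right)
    also have "x + (a - 1) * Suc x = (a - 1) + a * x" using assms by (cases a) auto
    finally have "(1 - ?X ^ (a - 1)) * ker x = ?X ^ x - ?X ^ (a - 1) * ?X ^ (a * x)"
      by (simp only: power_add)
    then show "(1 - ?X ^ (a - 1)) * (ker x * ?t x) = ?X ^ (1 * x) * ?t x - ?X ^ (a - 1) * (?X ^ (a * x) * ?t x)"
      by (simp only: left_diff_distrib mult_1 flip: mult.assoc)
  qed
  finally show ?thesis
    unfolding fps_series_diff moment_def by (simp only: fps_series_cmult ascending_X_power a)
qed

lemma tower_0:
  "(1 - fps_X) ^ 2 * tower {..0} 0 e = 1 - fps_X ^ Suc e"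
proof -
  let ?S = "{(e, 0), (0, 0)} :: cell set"
  have S: "insert (e, 0) ({0} \<times> {..0}) = ?S" by auto
  have D: "head (?S\<inverse>) = {0, e}" "(tail (?S\<inverse>))\<inverse> = {}" by auto
  have emp: "rjoin {} {} = ({} :: cell set)"
  proof -
    have "(i, j) \<notin> rjoin {} {}" for i j by (cases j) auto
    then show ?thesis by auto
  qed
  have "bij_betw (\<lambda>K. (rjoin K {}, {} :: cell set)) (row_sets {0, e} e) (row_configs ?S {#})"
    unfolding bij_betw_def
  proof
    show "inj_on (\<lambda>K. (rjoin K {}, {} :: cell set)) (row_sets {0, e} e)"
      by (auto simp: inj_on_def rjoin_inject)
    show "(\<lambda>K. (rjoin K {}, {} :: cell set)) ` row_sets {0, e} e = row_configs ?S {#}"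
    proof (intro equalityI subsetI)
      fix y assume "y \<in> (\<lambda>K. (rjoin K {}, {} :: cell set)) ` row_sets {0, e} e"
      then obtain K where K: "K \<in> row_sets {0, e} e" "y = (rjoin K {}, rjoin {} {})" by (auto simp: emp)
      then have "y \<in> configs ?S"
        using configs_empty by (auto simp: configs_rjoin D row_sets_def)
      then show "y \<in> row_configs ?S {#}" using K by (simp add: row_configs_def emp rows_def)
    next
      fix y assume y: "y \<in> row_configs ?S {#}"
      obtain K h s where y_eq: "y = (rjoin K h, s)" by (metis rjoin_cases surj_pair)
      have "finite s" "rows s = {#}" using y by (auto simp: y_eq row_configs_def configs_def)
      then have s: "s = {}" by (metis card_0_eq size_empty size_rows)
      then have "(rjoin K h, rjoin {} {}) \<in> configs ?S" using y by (simp add: y_eq row_configs_def emp)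
      then have "finite K" "K \<subseteq> {0, e} \<union> Suc ` K" "(h, {}) \<in> configs {}"
        by (auto simp: configs_rjoin D)
      then show "y \<in> (\<lambda>K. (rjoin K {}, {} :: cell set)) ` row_sets {0, e} e"
        using y_eq s by (auto simp: row_sets_def configs_empty)
    qed
  qed
  then have "tower {..0} 0 e = row_gf {0, e} e"
    unfolding tower_def row_gf_def S lessThan_0 mset_set.empty
    by (rule wgf_bij[symmetric]) (auto simp: card_rjoin row_sets_def)
  then show ?thesis by (simp add: row_gf_two_sources)
qed

lemma moment_tower_0:
  assumes "a \<ge> 1"
  shows "(1 - fps_X ^ a) * (1 - fps_X ^ Suc a) * ((1 - fps_X) ^ 2 * moment a (tower {..0} 0)) =
    (1 - fps_X ^ Suc a) - fps_X * (1 - fps_X ^ a)"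
proof -
  let ?X = "fps_X :: rat fps"
  have asc: "ascending (\<lambda>e. ?X ^ (a * e))" "ascending (\<lambda>e. ?X ^ (Suc a * e))"
    using ascending_X_power[of a "\<lambda>_. 1"] ascending_X_power[of "Suc a" "\<lambda>_. 1"] assms by simp_all
  have "(1 - ?X) ^ 2 * moment a (tower {..0} 0) = fps_series (\<lambda>e. (1 - ?X) ^ 2 * (?X ^ (a * e) * tower {..0} 0 e))"
    unfolding moment_def by (rule fps_series_cmult[symmetric]) (rule ascending_X_power[OF assms])
  also have "\<dots> = fps_series (\<lambda>e. ?X ^ (a * e) - ?X * ?X ^ (Suc a * e))"
    by (rule arg_cong[of _ _ fps_series], rule ext)
      (simp only: mult.left_commute[of "(1 - ?X) ^ 2"] tower_0, simp add: algebra_simps power_add)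
  also have "\<dots> = fps_series (\<lambda>e. ?X ^ (a * e)) - ?X * fps_series (\<lambda>e. ?X ^ (Suc a * e))"
    by (simp only: fps_series_diff fps_series_cmult asc)
  finally have eq: "(1 - ?X) ^ 2 * moment a (tower {..0} 0) =
    fps_series (\<lambda>e. ?X ^ (a * e)) - ?X * fps_series (\<lambda>e. ?X ^ (Suc a * e))" .
  have "(1 - ?X ^ a) * (1 - ?X ^ Suc a) * ((1 - ?X) ^ 2 * moment a (tower {..0} 0)) =
    (1 - ?X ^ Suc a) * ((1 - ?X ^ a) * fps_series (\<lambda>e. ?X ^ (a * e))) -
    ?X * (1 - ?X ^ a) * ((1 - ?X ^ Suc a) * fps_series (\<lambda>e. ?X ^ (Suc a * e)))"
    unfolding eq by (simp only: algebra_simps)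
  then show ?thesis using assms by (simp only: geometric_series le_SucI mult_1_right)
qed

lemma tower_first_row:
  assumes "finite A" "0 \<in> A"
  shows "(1 - fps_X) * tower A (Suc n) 0 = moment 1 (tower {j. Suc j \<in> A} n)"
proof -
  have D: "sources A 0 = {0}" using assms by (simp add: sources_def)
  have "tower A (Suc n) 0 = fps_series (\<lambda>x. row_gf {0} x * tower {j. Suc j \<in> A} n x)"
    using tower_Suc[OF assms(1), of 0 n] D by simp
  moreover have "ascending (\<lambda>x. row_gf {0} x * tower {j. Suc j \<in> A} n x)"
    using ascending_kernel[of "{0}" 0] by (simp add: ascending_mult_right)
  ultimately have "(1 - fps_X) * tower A (Suc n) 0 = fps_series (\<lambda>x. (1 - fps_X) * (row_gf {0} x * tower {j. Suc j \<in> A} n x))"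
    by (simp only: fps_series_cmult)
  then show ?thesis
    by (simp add: moment_def row_gf_one_source flip: mult.assoc)
qed

lemma completion_gf_eq_tower: "0 \<in> A \<Longrightarrow> completion_gf A (mset_set {..<n}) = tower A n 0"
  unfolding completion_gf_def tower_def by (simp add: insert_absorb)

lemma regular_cancel_X: "regular z ((1 - fps_X) * F) \<Longrightarrow> z \<noteq> 1 \<Longrightarrow> regular z F"
  using regular_cancel[of z 1 F] by simp

lemma regular_cancel_kernel:
  assumes "regular z ((1 - fps_X ^ a) * (1 - fps_X ^ b) * F)" "z ^ a \<noteq> 1" "z ^ b \<noteq> 1"
  shows "regular z F"
  by (rule regular_cancel[OF regular_cancel[OF assms(1)[unfolded mult.assoc] assms(2)] assms(3)])

lemma regular_cancel_square:
  assumes "regular z ((1 - fps_X) ^ 2 * F)" "z \<noteq> 1"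
  shows "regular z F"
proof -
  have "regular z ((1 - fps_X) * ((1 - fps_X) * F))"
    using assms(1) by (simp only: power2_eq_square mult.assoc)
  from regular_cancel_X[OF regular_cancel_X[OF this assms(2)] assms(2)] show ?thesis .
qed

definition simple_pole :: "nat \<Rightarrow> complex \<Rightarrow> rat fps \<Rightarrow> bool" where
  "simple_pole k z F \<longleftrightarrow> (\<exists>v. v \<noteq> 0 \<and> has_value z ((1 - fps_X ^ k) * F) v)"

lemma simple_pole_cancel:
  assumes "simple_pole k z ((1 - fps_X ^ c) * F)" "z ^ c \<noteq> 1"
  shows "simple_pole k z F"
proof -
  obtain v where v: "v \<noteq> 0" "has_value z ((1 - fps_X ^ k) * ((1 - fps_X ^ c) * F)) v"
    using assms by (auto simp: simple_pole_def)
  then have "has_value z ((1 - fps_X ^ k) * F) (v / (1 - z ^ c))"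
    using assms(2) by (intro has_value_cancel) (simp_all add: mult.left_commute)
  then show ?thesis unfolding simple_pole_def using v assms(2)
    by (intro exI[of _ "v / (1 - z ^ c)"] conjI) simp_all
qed

lemma simple_pole_cancel_square:
  assumes "simple_pole k z ((1 - fps_X) ^ 2 * F)" "z \<noteq> 1"
  shows "simple_pole k z F"
proof -
  have "simple_pole k z ((1 - fps_X ^ 1) * ((1 - fps_X ^ 1) * F))"
    using assms(1) by (simp only: power2_eq_square mult.assoc power_one_right)
  then show ?thesis using assms(2) simple_pole_cancel[of k z 1] by (metis power_one_right)
qed

lemma simple_pole_diff:
  assumes "simple_pole k z F" "regular z G" "z ^ k = 1"
  shows "simple_pole k z (F - G)"
proof -
  obtain v where v: "v \<noteq> 0" "has_value z ((1 - fps_X ^ k) * F) v"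
    using assms by (auto simp: simple_pole_def)
  have "has_value z ((1 - fps_X ^ k) * F - (1 - fps_X ^ k) * G) (v - 0)"
    by (intro has_value_diff v regular_residue assms)
  then show ?thesis unfolding simple_pole_def using v by (auto simp: right_diff_distrib)
qed

lemma simple_pole_mult:
  assumes "simple_pole k z F" "has_value z C c" "c \<noteq> 0"
  shows "simple_pole k z (C * F)"
proof -
  obtain v where v: "v \<noteq> 0" "has_value z ((1 - fps_X ^ k) * F) v"
    using assms by (auto simp: simple_pole_def)
  have "has_value z (C * ((1 - fps_X ^ k) * F)) (c * v)"
    by (intro has_value_mult v assms)
  then show ?thesis unfolding simple_pole_def using v assms(3)
    by (intro exI[of _ "c * v"] conjI) (simp_all add: mult.left_commute)
qed

lemma regular_moment_1:
  assumes "primitive_root k z" "n + 2 < k"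
  shows "regular z (moment 1 (tower {..n} n))"
proof -
  have "moment 1 (tower {..n} n) = (1 - fps_X) * completion_gf {..Suc n} (mset_set {..<Suc n})"
    using tower_first_row[of "{..Suc n}" n] completion_gf_eq_tower[of "{..Suc n}" "Suc n"] unfolding pred_atMost by simp
  moreover have "regular z (completion_gf {..Suc n} (mset_set {..<Suc n}))"
    using assms(2) by (intro regular_completion_gf[OF assms(1)]) auto
  ultimately show ?thesis by (simp add: regular_intros)
qed

lemma regular_open:
  assumes z: "primitive_root k z" and "a \<ge> 1" "a + n + 2 \<le> k"
    and reg: "a \<ge> 2 \<Longrightarrow> regular z (moment a (tower {..n} n))"
  shows "regular z ((1 - fps_X) * moment a (tower {1..Suc n} (Suc n)))"
proof (cases "a = 1")
  case True
  let ?A = "{..Suc (Suc n)} - {1}"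
  have "{j. Suc j \<in> ?A} = {1..Suc n}" by auto
  then have "moment a (tower {1..Suc n} (Suc n)) = (1 - fps_X) * completion_gf ?A (mset_set {..<Suc (Suc n)})"
    using tower_first_row[of ?A "Suc n"] completion_gf_eq_tower[of ?A "Suc (Suc n)"] True by simp
  moreover have "regular z (completion_gf ?A (mset_set {..<Suc (Suc n)}))"
    using assms(3) True by (intro regular_completion_gf[OF z]) auto
  ultimately show ?thesis by (simp add: regular_intros)
next
  case False
  then have a: "a \<ge> 2" using assms(2) by simp
  show ?thesis
  proof (rule regular_cancel)
    show "regular z ((1 - fps_X ^ (a - 1)) * ((1 - fps_X) * moment a (tower {1..Suc n} (Suc n))))"
      unfolding moment_open[OF a]
      using assms(3) a by (intro regular_intros regular_moment_1[OF z] reg) auto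
    show "z ^ (a - 1) \<noteq> 1" using a assms(3) by (intro primitive_rootD(2)[OF z]) auto
  qed
qed

lemma regular_moment:
  assumes z: "primitive_root k z" and "a \<ge> 1" "a + n + 1 < k"
  shows "regular z (moment a (tower {..n} n))"
  using assms(2,3)
proof (induction n arbitrary: a)
  case 0
  have zn: "z ^ a \<noteq> 1" "z ^ Suc a \<noteq> 1" "z \<noteq> 1"
    using primitive_rootD(2)[OF z, of a] primitive_rootD(2)[OF z, of "Suc a"] primitive_rootD(2)[OF z, of 1] 0 by auto
  have "regular z ((1 - fps_X ^ a) * (1 - fps_X ^ Suc a) * ((1 - fps_X) ^ 2 * moment a (tower {..0} 0)))"
    unfolding moment_tower_0[OF 0(1)] by (intro regular_intros)
  from regular_cancel_kernel[OF this zn(1,2)] show ?case by (rule regular_cancel_square[OF _ zn(3)])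
next
  case (Suc n)
  have zn: "z ^ a \<noteq> 1" "z ^ Suc a \<noteq> 1" "z \<noteq> 1"
    using primitive_rootD(2)[OF z, of a] primitive_rootD(2)[OF z, of "Suc a"] primitive_rootD(2)[OF z, of 1] Suc.prems by auto
  let ?Y = "(1 - fps_X) * moment a (tower {1..Suc n} (Suc n))"
  have Y: "regular z ?Y"
    using Suc.prems by (intro regular_open[OF z] Suc.IH) auto
  have "regular z ((1 - fps_X ^ a) * (1 - fps_X ^ Suc a) * ((1 - fps_X) ^ 2 * moment a (tower {..Suc n} (Suc n)) - ?Y))"
    unfolding moment_full_minus_open[OF Suc.prems(1)]
    using Suc.prems by (intro regular_intros Suc.IH regular_moment_1[OF z]) auto
  from regular_intros(4)[OF regular_cancel_kernel[OF this zn(1,2)] Y]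
  have "regular z ((1 - fps_X) ^ 2 * moment a (tower {..Suc n} (Suc n)))" by simp
  then show ?case by (rule regular_cancel_square[OF _ zn(3)])
qed

lemma kernel_nonzero:
  assumes z: "primitive_root k z" and "k \<ge> 3"
  shows "1 + z - z ^ 2 - z ^ Suc a \<noteq> 0"
proof
  define w where "w = z ^ Suc a"
  have z12: "z \<noteq> 1" "z ^ 2 \<noteq> 1"
    using primitive_rootD(2)[OF z, of 1] primitive_rootD(2)[OF z, of 2] assms(2) by auto
  assume "1 + z - z ^ 2 - z ^ Suc a = 0"
  then have eq: "1 + z = z ^ 2 + w" by (simp add: w_def diff_eq_eq add.commute)
  have "norm z ^ k = 1" using primitive_rootD(1)[OF z] by (metis norm_one norm_power)
  then have nz: "norm z = 1" using assms(2) power_eq_imp_eq_base[of "norm z" k 1] by simp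
  then have "z \<noteq> 0" "w \<noteq> 0" by (auto simp: w_def)
  have cnj: "cnj u = 1 / u" if "norm u = 1" for u
    using that by (metis complex_div_cnj div_by_1 mult_1 of_real_1 power_one)
  have "norm w = 1" by (simp add: w_def norm_power norm_mult nz)
  then have "1 + 1 / z = 1 / z ^ 2 + 1 / w"
    using arg_cong[OF eq, of cnj] by (simp add: cnj nz power_one_over)
  then have "(1 + z) * (z * w) = z ^ 2 + w"
    using \<open>z \<noteq> 0\<close> \<open>w \<noteq> 0\<close> by (simp add: field_simps power2_eq_square)
  then have "(1 + z) * (z * w) - (1 + z) * 1 = 0" using eq by (metis mult_1_right right_minus_eq)
  then have "(1 + z) * (z * w - 1) = 0" by (simp only: right_diff_distrib)
  moreover have "1 + z \<noteq> 0"
  proof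
    assume "1 + z = 0"
    then have "z = - 1" by (simp add: eq_neg_iff_add_eq_0 add.commute)
    then show False using z12 by simp
  qed
  ultimately have zw: "z * w = 1" by simp
  have "(z ^ 2 - 1) * (z ^ 2 - z) = z ^ 2 * (z ^ 2 - (1 + z)) + z" by (simp add: algebra_simps power2_eq_square)
  also have "\<dots> = z - z * (z * w)" unfolding eq by (simp add: algebra_simps power2_eq_square)
  also have "\<dots> = 0" by (simp add: zw)
  finally show False using z12 \<open>z \<noteq> 0\<close> by (simp add: power2_eq_square)
qed

lemma simple_pole_moment:
  assumes z: "primitive_root k z" and "a \<ge> 1" "a + n + 1 = k"
  shows "simple_pole k z (moment a (tower {..n} n))"
  using assms(2,3)
proof (induction n arbitrary: a)
  case 0
  have zn: "z ^ a \<noteq> 1" "z \<noteq> 1"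
    using primitive_rootD(2)[OF z, of a] primitive_rootD(2)[OF z, of 1] 0 by auto
  have k: "Suc a = k" using 0 by simp
  have "has_value z ((1 - fps_X ^ k) - fps_X * (1 - fps_X ^ a)) ((1 - z ^ k) - z * (1 - z ^ a))"
    by (intro has_value_intros)
  also have "(1 - fps_X ^ k) - fps_X * (1 - fps_X ^ a) =
      (1 - fps_X ^ k) * ((1 - fps_X ^ a) * ((1 - fps_X) ^ 2 * moment a (tower {..0} 0)))"
    using moment_tower_0[OF 0(1)] unfolding k by (simp only: mult_ac)
  finally have "has_value z ((1 - fps_X ^ k) * ((1 - fps_X ^ a) * ((1 - fps_X) ^ 2 * moment a (tower {..0} 0)))) (- z * (1 - z ^ a))"
    using primitive_rootD(1)[OF z] by simp
  moreover have "z \<noteq> 0" using primitive_rootD(1)[OF z] k by (auto simp: zero_power)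
  ultimately have "simple_pole k z ((1 - fps_X ^ a) * ((1 - fps_X) ^ 2 * moment a (tower {..0} 0)))"
    unfolding simple_pole_def using zn by (intro exI[of _ "- z * (1 - z ^ a)"]) auto
  from simple_pole_cancel[OF this zn(1)] show ?case by (rule simple_pole_cancel_square[OF _ zn(2)])
next
  case (Suc n)
  have zn: "z ^ a \<noteq> 1" "z ^ Suc a \<noteq> 1" "z \<noteq> 1"
    using primitive_rootD(2)[OF z, of a] primitive_rootD(2)[OF z, of "Suc a"] primitive_rootD(2)[OF z, of 1] Suc.prems by auto
  have zk: "z ^ k = 1" using primitive_rootD(1)[OF z] .
  have "z \<noteq> 0" using zk Suc.prems by (auto simp: zero_power)
  let ?Y = "(1 - fps_X) * moment a (tower {1..Suc n} (Suc n))"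
  have Y: "regular z ?Y"
    using Suc.prems by (intro regular_open[OF z] regular_moment[OF z]) auto
  have "simple_pole k z ((1 - fps_X ^ a) * (1 - fps_X ^ Suc a) * ((1 - fps_X) ^ 2 * moment a (tower {..Suc n} (Suc n)) - ?Y))"
    unfolding moment_full_minus_open[OF Suc.prems(1)]
  proof (rule simple_pole_diff[OF _ _ zk])
    show "regular z (fps_X * (1 - fps_X ^ Suc a) * moment 1 (tower {..n} n))"
      using Suc.prems by (intro regular_intros regular_moment_1[OF z]) auto
    show "simple_pole k z (fps_X ^ a * (1 + fps_X - fps_X ^ 2 - fps_X ^ Suc a) * moment (Suc a) (tower {..n} n))"
    proof (rule simple_pole_mult)
      show "simple_pole k z (moment (Suc a) (tower {..n} n))" using Suc.prems by (intro Suc.IH) auto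
      show "has_value z (fps_X ^ a * (1 + fps_X - fps_X ^ 2 - fps_X ^ Suc a)) (z ^ a * (1 + z - z ^ 2 - z ^ Suc a))"
        by (intro has_value_intros)
      show "z ^ a * (1 + z - z ^ 2 - z ^ Suc a) \<noteq> 0"
        using kernel_nonzero[OF z, of a] Suc.prems \<open>z \<noteq> 0\<close> by simp
    qed
  qed
  then have "simple_pole k z ((1 - fps_X) ^ 2 * moment a (tower {..Suc n} (Suc n)) - ?Y)"
    unfolding mult.assoc by (rule simple_pole_cancel[OF simple_pole_cancel[OF _ zn(1)] zn(2)])
  moreover have "regular z (0 - ?Y)" by (rule regular_intros(5)[OF regularI[OF has_value_0] Y])
  ultimately have "simple_pole k z ((1 - fps_X) ^ 2 * moment a (tower {..Suc n} (Suc n)) - ?Y - (0 - ?Y))"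
    by (rule simple_pole_diff[OF _ _ zk])
  then have "simple_pole k z ((1 - fps_X) ^ 2 * moment a (tower {..Suc n} (Suc n)))" by simp
  then show ?case by (rule simple_pole_cancel_square[OF _ zn(3)])
qed

lemma simple_pole_right_part:
  assumes z: "primitive_root k z" and "k \<ge> 1"
  shows "simple_pole k z (completion_gf {..<k} (mset_set {..<k - 1}))"
proof (cases "k = 1")
  case True
  have "(1 - fps_X) ^ 2 * tower {..0} 0 0 = (1 - fps_X) * 1" using tower_0[of 0] by simp
  then have "(1 - fps_X) * ((1 - fps_X) * tower {..0} 0 0) = (1 - fps_X) * 1"
    by (simp only: power2_eq_square mult.assoc)
  then have "(1 - fps_X) * tower {..0} 0 0 = 1"
    using one_minus_X_power_neq_0[of 1] mult_left_cancel[of "1 - fps_X"] by (metis power_one_right zero_less_one)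
  moreover have "completion_gf {..<k} (mset_set {..<k - 1}) = tower {..0} 0 0"
    using completion_gf_eq_tower[of "{..0}" 0] True by (simp add: lessThan_Suc_atMost)
  ultimately have "has_value z ((1 - fps_X ^ k) * completion_gf {..<k} (mset_set {..<k - 1})) 1"
    using True has_value_1 by simp
  then show ?thesis unfolding simple_pole_def by (intro exI[of _ 1]) simp
next
  case False
  then obtain n where n: "k = n + 2" using assms(2) that[of "k - 2"] by simp
  have "(1 - fps_X) * completion_gf {..<k} (mset_set {..<k - 1}) = moment 1 (tower {..n} n)"
    using tower_first_row[of "{..Suc n}" n] completion_gf_eq_tower[of "{..Suc n}" "Suc n"]
    unfolding pred_atMost by (simp add: n lessThan_Suc_atMost)
  moreover have "simple_pole k z (moment 1 (tower {..n} n))"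
    using n by (intro simple_pole_moment[OF z]) auto
  ultimately show ?thesis
    using simple_pole_cancel[of k z 1] primitive_rootD(2)[OF z, of 1] n by simp
qed

section \<open>Directed bond-animals as configurations\<close>

definition hbond :: "cell \<Rightarrow> bond" where
  "hbond c = {(int (fst c), int (snd c)), (int (fst c) + 1, int (snd c))}"

definition vbond :: "cell \<Rightarrow> bond" where
  "vbond c = {(int (fst c), int (snd c)), (int (fst c), int (snd c) + 1)}"

definition bonds_of :: "cell set \<times> cell set \<Rightarrow> bond set" where
  "bonds_of z = hbond ` fst z \<union> vbond ` snd z"

definition animal_of :: "cell set \<times> cell set \<Rightarrow> animal" where
  "animal_of z = (insert (0, 0) (\<Union> (bonds_of z)), bonds_of z)"

lemma inj_hbond: "inj hbond" and inj_vbond: "inj vbond"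
  by (auto simp: inj_def hbond_def vbond_def doubleton_eq_iff)

lemma hbond_horizontal: "hbond c \<in> horizontal_bonds" "hbond c \<notin> vertical_bonds"
  by (auto simp: hbond_def horizontal_bonds_def vertical_bonds_def doubleton_eq_iff)

lemma vbond_vertical: "vbond c \<in> vertical_bonds" "vbond c \<notin> horizontal_bonds"
  by (auto simp: vbond_def horizontal_bonds_def vertical_bonds_def doubleton_eq_iff)

lemma bonds_of_horizontal: "bonds_of z \<inter> horizontal_bonds = hbond ` fst z"
  and bonds_of_vertical: "bonds_of z \<inter> vertical_bonds = vbond ` snd z"
  using hbond_horizontal vbond_vertical by (auto simp: bonds_of_def)

lemma hbond_in_bonds_of: "hbond c \<in> bonds_of z \<longleftrightarrow> c \<in> fst z"
proof -
  have "hbond c \<notin> vbond ` snd z" using hbond_horizontal vbond_vertical by (metis imageE)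
  then show ?thesis by (simp add: bonds_of_def inj_image_mem_iff[OF inj_hbond])
qed

lemma vbond_in_bonds_of: "vbond c \<in> bonds_of z \<longleftrightarrow> c \<in> snd z"
proof -
  have "vbond c \<notin> hbond ` fst z" using hbond_horizontal vbond_vertical by (metis imageE)
  then show ?thesis by (simp add: bonds_of_def inj_image_mem_iff[OF inj_vbond])
qed

lemma NE_steps_cell:
  "((int i, int j), w) \<in> NE_steps (bonds_of z) \<longleftrightarrow>
    (w = (int (Suc i), int j) \<and> (i, j) \<in> fst z) \<or> (w = (int i, int (Suc j)) \<and> (i, j) \<in> snd z)"
  using hbond_in_bonds_of[of "(i, j)" z] vbond_in_bonds_of[of "(i, j)" z]
  by (auto simp: NE_steps_def hbond_def vbond_def add.commute)

lemma configs_reachable: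
  assumes "(h, s) \<in> configs {(0, 0)}" "present {(0, 0)} h s (i, j)"
  shows "((0, 0), (int i, int j)) \<in> (NE_steps (bonds_of (h, s)))\<^sup>*"
  using assms(2)
proof (induction "i + j" arbitrary: i j rule: less_induct)
  case less
  consider "(i, j) = (0, 0)" | i' where "i = Suc i'" "(i', j) \<in> h" | j' where "j = Suc j'" "(i, j') \<in> s"
    using less.prems by (auto simp: present_def)
  then show ?case
  proof cases
    case (2 i')
    then have "present {(0, 0)} h s (i', j)" using assms(1) by (auto simp: configs_def)
    then have "((0, 0), (int i', int j)) \<in> (NE_steps (bonds_of (h, s)))\<^sup>*" using 2 by (intro less.hyps) auto
    moreover have "((int i', int j), (int i, int j)) \<in> NE_steps (bonds_of (h, s))"
      using 2 by (simp add: NE_steps_cell)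
    ultimately show ?thesis by (rule rtrancl_into_rtrancl)
  next
    case (3 j')
    then have "present {(0, 0)} h s (i, j')" using assms(1) by (auto simp: configs_def)
    then have "((0, 0), (int i, int j')) \<in> (NE_steps (bonds_of (h, s)))\<^sup>*" using 3 by (intro less.hyps) auto
    moreover have "((int i, int j'), (int i, int j)) \<in> NE_steps (bonds_of (h, s))"
      using 3 by (simp add: NE_steps_cell)
    ultimately show ?thesis by (rule rtrancl_into_rtrancl)
  qed simp
qed

lemma configs_bond_reached:
  assumes "(h, s) \<in> configs {(0, 0)}" "e \<in> bonds_of (h, s)"
  shows "\<exists>u v. e = {u, v} \<and> ((0, 0), u) \<in> (NE_steps (bonds_of (h, s)))\<^sup>* \<and> (u, v) \<in> NE_steps (bonds_of (h, s))"
proof -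
  obtain i j where ij: "(e = hbond (i, j) \<and> (i, j) \<in> h) \<or> (e = vbond (i, j) \<and> (i, j) \<in> s)"
    using assms(2) by (auto simp: bonds_of_def)
  then have "present {(0, 0)} h s (i, j)" using assms(1) by (auto simp: configs_def)
  then have "((0, 0), (int i, int j)) \<in> (NE_steps (bonds_of (h, s)))\<^sup>*" by (rule configs_reachable[OF assms(1)])
  moreover have "\<exists>v. e = {(int i, int j), v} \<and> ((int i, int j), v) \<in> NE_steps (bonds_of (h, s))"
    using ij by (auto simp: NE_steps_cell hbond_def vbond_def add.commute)
  ultimately show ?thesis by blast
qed

lemma animal_of_bond_animal:
  assumes "z \<in> configs {(0, 0)}"
  shows "bond_animal (animal_of z)"
proof -
  obtain h s where z: "z = (h, s)" by (cases z)
  let ?E = "bonds_of z" and ?R = "{(a, b). {a, b} \<in> bonds_of z}"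
  have fin: "finite ?E" using assms by (auto simp: z bonds_of_def configs_def)
  have "finite e" if "e \<in> ?E" for e using that by (auto simp: bonds_of_def hbond_def vbond_def)
  then have finV: "finite (insert (0, 0) (\<Union> ?E))" using fin by auto
  have sub: "?E \<subseteq> horizontal_bonds \<union> vertical_bonds"
    using hbond_horizontal vbond_vertical by (auto simp: bonds_of_def)
  have NE: "NE_steps ?E \<subseteq> ?R" by (auto simp: NE_steps_def)
  have reach: "((0, 0), v) \<in> ?R\<^sup>*" if v: "v \<in> insert (0, 0) (\<Union> ?E)" for v
  proof (cases "v = (0, 0)")
    case False
    then obtain e where "e \<in> ?E" "v \<in> e" using v by auto
    then obtain a b where ab: "e = {a, b}" "((0, 0), a) \<in> (NE_steps ?E)\<^sup>*" "(a, b) \<in> NE_steps ?E"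
      using configs_bond_reached[of h s e] assms unfolding z by blast
    then have "((0, 0), v) \<in> (NE_steps ?E)\<^sup>*" using \<open>v \<in> e\<close> by auto
    then show ?thesis using rtrancl_mono[OF NE] by blast
  qed simp
  have "sym ?R" by (auto simp: sym_def insert_commute)
  then have "sym (?R\<^sup>*)" by (rule sym_rtrancl)
  then have conn: "(u, v) \<in> ?R\<^sup>*" if "u \<in> insert (0, 0) (\<Union> ?E)" "v \<in> insert (0, 0) (\<Union> ?E)" for u v
    using reach[OF that(1)] reach[OF that(2)] by (meson rtrancl_trans symD)
  show ?thesis
    unfolding bond_animal_def animal_of_def prod.case by (intro conjI ballI finV sub conn) auto
qed

lemma animal_of_directed:
  assumes "z \<in> configs {(0, 0)}"
  shows "directed (animal_of z)"
proof -
  obtain h s where z: "z = (h, s)" by (cases z)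
  show ?thesis
    unfolding directed_def animal_of_def z prod.case
    using configs_bond_reached[of h s] assms z by (intro bexI[of _ "(0, 0)"]) auto
qed

lemma num_animal_of:
  "num_h (animal_of z) = card (fst z)" "num_v (animal_of z) = card (snd z)"
  using inj_hbond inj_vbond
  by (simp_all add: num_h_def num_v_def animal_of_def bonds_of_horizontal bonds_of_vertical card_image inj_on_subset)

lemma shift_shift: "shift t (shift u v) = shift (fst t + fst u, snd t + snd u) v"
  by (simp add: shift_def algebra_simps)

lemma inj_shift_vertex: "inj (shift t)"
  by (auto simp: inj_def shift_def prod_eq_iff)

lemma shift_horizontal: "shift t ` e \<in> horizontal_bonds \<longleftrightarrow> e \<in> horizontal_bonds"
  and shift_vertical: "shift t ` e \<in> vertical_bonds \<longleftrightarrow> e \<in> vertical_bonds"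
proof -
  have 1: "shift u ` f \<in> horizontal_bonds" if f: "f \<in> horizontal_bonds" for f u
  proof -
    obtain i j where "f = {(i, j), (i + 1, j)}" using f by (auto simp: horizontal_bonds_def)
    then have "shift u ` f = {(i + fst u, j + snd u), (i + fst u + 1, j + snd u)}" by (simp add: shift_def algebra_simps)
    then show ?thesis unfolding horizontal_bonds_def by blast
  qed
  have 2: "shift u ` f \<in> vertical_bonds" if f: "f \<in> vertical_bonds" for f u
  proof -
    obtain i j where "f = {(i, j), (i, j + 1)}" using f by (auto simp: vertical_bonds_def)
    then have "shift u ` f = {(i + fst u, j + snd u), (i + fst u, j + snd u + 1)}" by (simp add: shift_def algebra_simps)
    then show ?thesis unfolding vertical_bonds_def by blast
  qed
  have unshift: "shift (- fst t, - snd t) ` (shift t ` e) = e"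
    by (simp add: image_image shift_shift) (simp add: shift_def)
  show "shift t ` e \<in> horizontal_bonds \<longleftrightarrow> e \<in> horizontal_bonds"
    using 1[of "shift t ` e" "(- fst t, - snd t)"] 1[of e t] unshift by auto
  show "shift t ` e \<in> vertical_bonds \<longleftrightarrow> e \<in> vertical_bonds"
    using 2[of "shift t ` e" "(- fst t, - snd t)"] 2[of e t] unshift by auto
qed

lemma num_translate: "num_h (translate t A) = num_h A" "num_v (translate t A) = num_v A"
proof -
  have inj: "inj_on (\<lambda>e. shift t ` e) X" for X
    using inj_shift_vertex by (auto simp: inj_on_def inj_image_eq_iff)
  have "(\<lambda>e. shift t ` e) ` snd A \<inter> horizontal_bonds = (\<lambda>e. shift t ` e) ` (snd A \<inter> horizontal_bonds)"
    "(\<lambda>e. shift t ` e) ` snd A \<inter> vertical_bonds = (\<lambda>e. shift t ` e) ` (snd A \<inter> vertical_bonds)"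
    by (auto simp: shift_horizontal shift_vertical)
  then show "num_h (translate t A) = num_h A" "num_v (translate t A) = num_v A"
    by (simp_all add: num_h_def num_v_def translate_def card_image[OF inj])
qed

lemma translate_translate: "translate t (translate u A) = translate (fst t + fst u, snd t + snd u) A"
  by (simp add: translate_def image_image shift_shift)

lemma translation_class_eq: "translation_rel `` {translate t A} = translation_rel `` {A}"
proof -
  have "\<exists>v. translate u A = translate v (translate t A)" for u
    by (rule exI[of _ "(fst u - fst t, snd u - snd t)"]) (simp add: translate_translate)
  then show ?thesis by (auto simp: translation_rel_def translate_translate)
qed

lemma NE_reach_quadrant:
  assumes "(r, u) \<in> (NE_steps E)\<^sup>*"
  obtains i j where "u = (fst r + int i, snd r + int j)"
proof -
  have "\<exists>i j. u = (fst r + int i, snd r + int j)"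
    using assms
  proof (induction rule: rtrancl_induct)
    case base
    show ?case by (rule exI[of _ 0], rule exI[of _ 0]) simp
  next
    case (step v w)
    then obtain i j where v: "v = (fst r + int i, snd r + int j)" by blast
    then have "w = (fst r + int (Suc i), snd r + int j) \<or> w = (fst r + int i, snd r + int (Suc j))"
      using step(2) by (auto simp: NE_steps_def)
    then show ?case by blast
  qed
  then show ?thesis using that by blast
qed

lemma directed_animal_cases:
  assumes "bond_animal A" "directed A"
  obtains z t where "z \<in> configs {(0, 0)}" "A = translate t (animal_of z)"
proof -
  obtain V E where A: "A = (V, E)" by (cases A)
  have V: "finite V" "\<Union>E \<subseteq> V" and
    conn: "\<And>u v. u \<in> V \<Longrightarrow> v \<in> V \<Longrightarrow> (u, v) \<in> {(a, b). {a, b} \<in> E}\<^sup>*"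
    using assms(1) by (auto simp: bond_animal_def A)
  obtain r where r: "r \<in> V" and
    dir: "\<And>e. e \<in> E \<Longrightarrow> \<exists>u v. e = {u, v} \<and> (r, u) \<in> (NE_steps E)\<^sup>* \<and> (u, v) \<in> NE_steps E"
    using assms(2) by (auto simp: directed_def A)
  define h where "h = {c. shift r ` hbond c \<in> E}"
  define s where "s = {c. shift r ` vbond c \<in> E}"
  define pt where "pt = (\<lambda>i j. (fst r + int i, snd r + int j))"
  have pt_eq: "pt i j = pt i' j' \<longleftrightarrow> i = i' \<and> j = j'" for i j i' j' by (simp add: pt_def)
  have hb: "shift r ` hbond (i, j) = {pt i j, pt (Suc i) j}" and
    vb: "shift r ` vbond (i, j) = {pt i j, pt i (Suc j)}" for i j
    by (auto simp: hbond_def vbond_def shift_def pt_def)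
  have NE_cases: "(w = pt (Suc i) j \<and> (i, j) \<in> h) \<or> (w = pt i (Suc j) \<and> (i, j) \<in> s)"
    if "(pt i j, w) \<in> NE_steps E" for i j w
  proof -
    have "w = pt (Suc i) j \<or> w = pt i (Suc j)" "{pt i j, w} \<in> E"
      using that by (auto simp: NE_steps_def pt_def)
    then show ?thesis using hb[of i j] vb[of i j] by (auto simp: h_def s_def)
  qed
  have reach: "\<exists>i j. u = pt i j \<and> present {(0, 0)} h s (i, j)" if u: "(r, u) \<in> (NE_steps E)\<^sup>*" for u
    using u
  proof cases
    case base
    then have "u = pt 0 0" by (simp add: pt_def)
    moreover have "present {(0, 0)} h s (0, 0)" by (simp add: present_def)
    ultimately show ?thesis by blast
  next
    case (step v)
    obtain i j where v: "v = pt i j" using NE_reach_quadrant[OF step(1)] by (auto simp: pt_def)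
    then have "(u = pt (Suc i) j \<and> (i, j) \<in> h) \<or> (u = pt i (Suc j) \<and> (i, j) \<in> s)"
      using NE_cases step(2) by blast
    then show ?thesis
      by (auto simp: present_def intro: exI[of _ "Suc i"] exI[of _ j] exI[of _ i] exI[of _ "Suc j"])
  qed
  have bond: "\<exists>i j w. e = {pt i j, w} \<and> present {(0, 0)} h s (i, j) \<and>
      ((w = pt (Suc i) j \<and> (i, j) \<in> h) \<or> (w = pt i (Suc j) \<and> (i, j) \<in> s))" if "e \<in> E" for e
    using dir[OF that] reach NE_cases by metis
  have E_eq: "E = (\<lambda>e. shift r ` e) ` bonds_of (h, s)"
  proof (intro equalityI subsetI)
    fix e assume "e \<in> E"
    then obtain i j where "(e = {pt i j, pt (Suc i) j} \<and> (i, j) \<in> h) \<or> (e = {pt i j, pt i (Suc j)} \<and> (i, j) \<in> s)"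
      using bond by blast
    then show "e \<in> (\<lambda>e. shift r ` e) ` bonds_of (h, s)"
      unfolding hb[symmetric] vb[symmetric] by (auto simp: bonds_of_def)
  next
    fix e assume "e \<in> (\<lambda>e. shift r ` e) ` bonds_of (h, s)"
    then show "e \<in> E" by (auto simp: bonds_of_def h_def s_def)
  qed
  have finE: "finite E" using V finite_subset[of E "Pow V"] by auto
  have inj: "inj (\<lambda>e. shift r ` e)"
    using inj_shift_vertex by (auto simp: inj_on_def inj_image_eq_iff)
  have "finite (bonds_of (h, s))"
    using finE E_eq inj finite_image_iff inj_on_subset by (metis subset_UNIV)
  then have fin: "finite h" "finite s"
    using inj_hbond inj_vbond by (auto simp: bonds_of_def finite_image_iff inj_on_subset)
  have "present {(0, 0)} h s c" if "c \<in> h \<union> s" for c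
  proof -
    obtain a b where c: "c = (a, b)" by (cases c)
    have "{pt a b, pt (Suc a) b} \<in> E \<or> {pt a b, pt a (Suc b)} \<in> E"
      using that hb[of a b] vb[of a b] by (auto simp: c h_def s_def)
    then obtain w where w: "{pt a b, w} \<in> E" "w = pt (Suc a) b \<or> w = pt a (Suc b)" by blast
    obtain i j w' where *: "{pt a b, w} = {pt i j, w'}" "present {(0, 0)} h s (i, j)"
      "w' = pt (Suc i) j \<or> w' = pt i (Suc j)"
      using bond[OF w(1)] by blast
    have "(i, j) = (a, b)"
      using *(1,3) w(2) by (auto simp: doubleton_eq_iff pt_eq)
    then show ?thesis using *(2) c by simp
  qed
  then have conf: "(h, s) \<in> configs {(0, 0)}" using fin by (auto simp: configs_def)
  have "V = insert r (\<Union>E)"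
  proof
    show "insert r (\<Union>E) \<subseteq> V" using r V by auto
    show "V \<subseteq> insert r (\<Union>E)"
    proof
      fix v assume v: "v \<in> V"
      have "(v, r) \<in> {(a, b). {a, b} \<in> E}\<^sup>*" using conn v r by blast
      then show "v \<in> insert r (\<Union>E)" by (cases rule: converse_rtranclE) auto
    qed
  qed
  also have "\<dots> = shift r ` insert (0, 0) (\<Union>(bonds_of (h, s)))"
    by (subst E_eq) (auto simp: shift_def)
  finally have "A = translate r (animal_of (h, s))"
    using E_eq by (simp add: A translate_def animal_of_def)
  then show ?thesis using conf that by blast
qed

lemma animal_of_translate_inj:
  assumes "animal_of z' = translate t (animal_of z)"
  shows "z' = z"
proof -
  have nonneg: "fst v \<ge> 0 \<and> snd v \<ge> 0" if "v \<in> fst (animal_of y)" for v y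
    using that by (auto simp: animal_of_def bonds_of_def hbond_def vbond_def)
  have zero: "(0, 0) \<in> fst (animal_of y)" for y by (simp add: animal_of_def)
  have V: "fst (animal_of z') = shift t ` fst (animal_of z)"
    using assms by (simp add: translate_def)
  have "shift t (0, 0) \<in> fst (animal_of z')" using zero[of z] V by blast
  then have 1: "fst t \<ge> 0" "snd t \<ge> 0" using nonneg[of "shift t (0, 0)" z'] by (auto simp: shift_def)
  obtain v where "v \<in> fst (animal_of z)" "(0, 0) = shift t v" using zero[of z'] V by blast
  then have "fst t \<le> 0" "snd t \<le> 0" using nonneg[of v z] by (auto simp: shift_def)
  then have "shift t = (\<lambda>v. v)" using 1 by (auto simp: shift_def)
  then have "bonds_of z' = bonds_of z"
    using arg_cong[OF assms, of snd] by (simp add: translate_def animal_of_def)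
  then have "fst z' = fst z" "snd z' = snd z"
    using hbond_in_bonds_of vbond_in_bonds_of by blast+
  then show ?thesis by (simp add: prod_eq_iff)
qed

lemma card_directed_animals:
  "card (directed_animals m n) = card {z\<in>configs {(0, 0)}. card (fst z) = m \<and> card (snd z) = n}"
proof -
  let ?Z = "{z\<in>configs {(0, 0)}. card (fst z) = m \<and> card (snd z) = n}"
  let ?f = "\<lambda>z. translation_rel `` {animal_of z}"
  have "bij_betw ?f ?Z (directed_animals m n)"
    unfolding bij_betw_def
  proof
    show "inj_on ?f ?Z"
    proof (rule inj_onI)
      fix z z' assume "?f z = ?f z'"
      moreover have "animal_of z' \<in> ?f z'"
        by (auto simp: translation_rel_def translate_def shift_def intro!: exI[of _ 0])
      ultimately have "animal_of z' \<in> ?f z" by simp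
      then obtain t where "animal_of z' = translate t (animal_of z)"
        unfolding translation_rel_def by blast
      then show "z = z'" using animal_of_translate_inj by metis
    qed
    show "?f ` ?Z = directed_animals m n"
    proof (intro equalityI subsetI)
      fix C assume "C \<in> ?f ` ?Z"
      then obtain z where z: "z \<in> ?Z" "C = ?f z" by blast
      then have "animal_of z \<in> {A. bond_animal A \<and> directed A \<and> num_h A = m \<and> num_v A = n}"
        by (simp add: animal_of_bond_animal animal_of_directed num_animal_of)
      then show "C \<in> directed_animals m n"
        unfolding directed_animals_def z(2) by (rule quotientI)
    next
      fix C assume "C \<in> directed_animals m n"
      then obtain A where A: "bond_animal A" "directed A" "num_h A = m" "num_v A = n" "C = translation_rel `` {A}"
        by (auto simp: directed_animals_def quotient_def)
      obtain z t where z: "z \<in> configs {(0, 0)}" "A = translate t (animal_of z)"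
        using directed_animal_cases[OF A(1,2)] by blast
      have "z \<in> ?Z" using A z by (auto simp: num_translate num_animal_of)
      moreover have "C = ?f z" using A(5) z(2) translation_class_eq by simp
      ultimately show "C \<in> ?f ` ?Z" by blast
    qed
  qed
  from bij_betw_same_card[OF this] show ?thesis by (rule sym)
qed

lemma finite_bounded_multisets:
  "finite {M :: nat multiset. size M = n \<and> set_mset M \<subseteq> {..<b}}"
proof (rule finite_subset)
  show "{M. size M = n \<and> set_mset M \<subseteq> {..<b}} \<subseteq> mset ` {xs. set xs \<subseteq> {..<b} \<and> length xs = n}"
  proof
    fix M assume M: "M \<in> {M. size M = n \<and> set_mset M \<subseteq> {..<b}}"
    obtain xs where "mset xs = M" by (metis ex_mset)
    then show "M \<in> mset ` {xs. set xs \<subseteq> {..<b} \<and> length xs = n}" using M by force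
  qed
qed (simp add: finite_lists_length_eq)

lemma H_eq_sum_completion_gf:
  "H n = (\<Sum>M | size M = n \<and> set_mset M \<subseteq> {..<n}. completion_gf {0} M)"
proof -
  let ?I = "{M. size M = n \<and> set_mset M \<subseteq> {..<n}}"
  let ?Z = "{z\<in>configs {(0, 0)}. card (snd z) = n}"
  have fin: "finite ?I" by (rule finite_bounded_multisets)
  have ff: "finite_fibres (row_configs {(0, 0)} M) hcard" for M
    by (rule finite_fibres_configs) simp
  have rows: "rows (snd z) \<in> ?I" if "z \<in> ?Z" for z
  proof -
    obtain h s where z: "z = (h, s)" by (cases z)
    have hs: "(h, s) \<in> configs {(0, 0)}" "finite s" using that by (auto simp: z configs_def)
    have "j < n" if "(i, j) \<in> s" for i j
    proof -
      have "j \<le> 0 + card {p\<in>s. snd p < j}"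
        by (rule configs_row_bound[OF hs(1), of _ i]) (use that in auto)
      moreover have "{p\<in>s. snd p < j} \<subset> s"
      proof -
        have "(i, j) \<in> s - {p\<in>s. snd p < j}" using that by simp
        then show ?thesis by blast
      qed
      then have "card {p\<in>s. snd p < j} < card s" using hs(2) by (rule psubset_card_mono[rotated])
      ultimately show ?thesis using \<open>z \<in> ?Z\<close> by (simp add: z)
    qed
    then show ?thesis using that hs(2) by (auto simp: z)
  qed
  have "H n = wgf ?Z hcard"
    by (rule fps_ext) (auto simp: H_def wgf_nth card_directed_animals hcard_def intro!: arg_cong[of _ _ card])
  also have "\<dots> = wgf (Sigma ?I (row_configs {(0, 0)})) (\<lambda>z. hcard (snd z))"
  proof (rule wgf_bij[of "\<lambda>z. (rows (snd z), z)"])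
    show "bij_betw (\<lambda>z. (rows (snd z), z)) ?Z (Sigma ?I (row_configs {(0, 0)}))"
      unfolding bij_betw_def
    proof
      show "inj_on (\<lambda>z. (rows (snd z), z)) ?Z" by (auto simp: inj_on_def)
      show "(\<lambda>z. (rows (snd z), z)) ` ?Z = Sigma ?I (row_configs {(0, 0)})"
      proof (intro equalityI subsetI)
        fix y assume "y \<in> (\<lambda>z. (rows (snd z), z)) ` ?Z"
        then obtain z where "z \<in> ?Z" "y = (rows (snd z), z)" by blast
        then show "y \<in> Sigma ?I (row_configs {(0, 0)})" using rows[of z] by (auto simp: row_configs_def)
      next
        fix y assume "y \<in> Sigma ?I (row_configs {(0, 0)})"
        then have "snd y \<in> ?Z" "y = (rows (snd (snd y)), snd y)"
          by (auto simp: row_configs_def)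
        then show "y \<in> (\<lambda>z. (rows (snd z), z)) ` ?Z" by blast
      qed
    qed
  qed simp
  also have "\<dots> = (\<Sum>M\<in>?I. wgf (row_configs {(0, 0)} M) hcard)"
    by (rule wgf_Sigma[OF fin ff])
  also have "\<dots> = (\<Sum>M\<in>?I. completion_gf {0} M)" by (simp add: completion_gf_def)
  finally show ?thesis .
qed

lemma simple_pole_H:
  assumes z: "primitive_root k z" and "k \<ge> 1"
  shows "simple_pole k z (H (2 * k - 2))"
proof -
  obtain \<sigma> where \<sigma>: "\<sigma> \<noteq> 0" "has_value z ((1 - fps_X ^ k) * completion_gf {..<k} (mset_set {..<k - 1})) \<sigma>"
    using simple_pole_right_part[OF assms] by (auto simp: simple_pole_def)
  let ?I = "{M. size M = 2 * k - 2 \<and> set_mset M \<subseteq> {..<2 * k - 2}}"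
  have "has_value z (\<Sum>M\<in>?I. (1 - fps_X ^ k) * completion_gf {0} M)
      (\<Sum>M\<in>?I. if M = critical k 1 then \<sigma> * left_factor k z 1 else 0)"
  proof (rule has_value_sum)
    fix M assume "M \<in> ?I"
    then have "has_value z ((1 - fps_X ^ k) * completion_gf {..<1} M) (if M = critical k 1 then \<sigma> * left_factor k z 1 else 0)"
      using assms(2) by (intro has_value_critical[OF z \<sigma>(2)]) auto
    moreover have "{..<1} = {0::nat}" by auto
    ultimately show "has_value z ((1 - fps_X ^ k) * completion_gf {0} M) (if M = critical k 1 then \<sigma> * left_factor k z 1 else 0)"
      by simp
  qed
  moreover have "(\<Sum>M\<in>?I. if M = critical k 1 then \<sigma> * left_factor k z 1 else 0) = \<sigma> * left_factor k z 1"
  proof -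
    have "critical k 1 \<in> ?I" by (auto simp: critical_def)
    moreover have "finite ?I" by (rule finite_bounded_multisets)
    ultimately show ?thesis by simp
  qed
  moreover have "left_factor k z 1 \<noteq> 0"
    using primitive_rootD(2)[OF z] by (auto simp: left_factor_def)
  ultimately show ?thesis
    unfolding simple_pole_def H_eq_sum_completion_gf sum_distrib_left using \<sigma>(1)
    by (intro exI[of _ "\<sigma> * left_factor k z 1"]) simp
qed

theorem mainTheorem1:
  fixes k :: nat
  assumes "k \<ge> 1"
  shows "(\<exists>p q. lowest_terms (H (2 * k - 2)) p q) \<and>
    (\<forall>p q. lowest_terms (H (2 * k - 2)) p q \<longrightarrow>
       Psi k dvd q \<and>
       (\<forall>z :: complex. poly (map_poly of_rat (Psi k)) z = 0 \<longrightarrow>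
          is_pole (\<lambda>w. poly (map_poly of_rat p) w / poly (map_poly of_rat q) w) z))"
proof (intro conjI allI impI)
  have k: "k > 0" using assms by simp
  obtain z where z: "primitive_root k z" using primitive_root_exists[OF k] .
  then show "\<exists>p q. lowest_terms (H (2 * k - 2)) p q"
    using simple_pole_H[OF z assms] has_value_imp_lowest_terms[OF _ k] by (auto simp: simple_pole_def)
  fix p q assume pq: "lowest_terms (H (2 * k - 2)) p q"
  have root: "ev z q = 0" if "ev z (Psi k) = 0" for z
  proof -
    have z: "primitive_root k z" using Psi_root_primitive[OF k that] .
    then obtain v where "v \<noteq> 0" "has_value z ((1 - fps_X ^ k) * H (2 * k - 2)) v"
      using simple_pole_H[OF z assms] by (auto simp: simple_pole_def)
    then show ?thesis
      using pq z by (auto intro: ev_denominator_eq_0 simp: lowest_terms_def primitive_root_def)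
  qed
  then show "Psi k dvd q" by (rule Psi_dvdI[OF k])
  fix z :: complex assume "poly (map_poly of_rat (Psi k)) z = 0"
  then have "ev z q = 0" by (intro root) (simp add: ev_def)
  then show "is_pole (\<lambda>w. poly (map_poly of_rat p) w / poly (map_poly of_rat q) w) z"
    using pq by (intro is_pole_rational) (auto simp: lowest_terms_def)
qed

end
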